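(* Let $f(\nu),g(\nu)$, $\nu\in\mathcal I$, be two differentiable functions with $f(\nu)-g(\nu)\neq0$ and $f'(\nu)g'(\nu)\neq0$, and let $\nu(u,v)=\nu(u)$, $(u,v)\in\mathcal D$, be a differentiable function (independent of $v$) with $\nu_u\neq0$ and $\nu(u,v)\in\mathcal I$. Let $(u_0,v_0)\in\mathcal D$, $\nu_0=\nu(u_0,v_0)$, and let $\mathfrak a>0$ be a constant. Put $$I=\int_{\nu_0}^{\nu}\frac{f'(\nu)\,d\nu}{f(\nu)-g(\nu)},\qquad J=\int_{\nu_0}^{\nu}\frac{g'(\nu)\,d\nu}{g(\nu)-f(\nu)},$$ regarded as functions of $u$ through $\nu=\nu(u)$. If $$\mathfrak a^2e^{2I}\left(J_{uu}+I_uJ_u-J_u^2\right)=-f(\nu)\,g(\nu),$$ then there exists a unique (up to a motion) time-like W-surface $\mathcal M:z=z(u,v)$, $(u,v)\in\mathcal D_0\subset\mathcal D$ (where $\mathcal D_0$ is a neighborhood of $(u_0,v_0)$), with invariants $$\nu_1=f(\nu),\quad \nu_2=g(\nu),\quad \gamma_1=0,\quad \gamma_2=\mathfrak a\,e^{I}J_u.$$ Furthermore, $(u,v)$ are natural principal parameters on $\mathcal M$.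
   Context: $\mathbb R^3_1$ is $\mathbb R^3$ with the flat metric $\langle x,y\rangle=x_1y_1+x_2y_2-x_3y_3$ and standard orientation; all surfaces lie in $\mathbb R^3_1$. Functions are assumed sufficiently smooth. For a time-like surface $z=z(u,v)$ let $l$ be the unit normal field, $\langle l,l\rangle=1$, and $E=\langle z_u,z_u\rangle<0$, $F=\langle z_u,z_v\rangle$, $G=\langle z_v,z_v\rangle>0$, $L=\langle l,z_{uu}\rangle$, $M=\langle l,z_{uv}\rangle$, $N=\langle l,z_{vv}\rangle$. Parameters are principal if $F=M=0$; surfaces are always considered in principal parameters and with distinct real principal curvatures. Set $X=z_u/\sqrt{-E}$, $Y=z_v/\sqrt G$; the frame $XYl$ is positively oriented. The principal curvatures and principal geodesic curvatures are $$\nu_1=\frac LE,\quad \nu_2=\frac NG,\quad \gamma_1=\frac{E_v}{2E\sqrt G},\quad \gamma_2=\frac{-G_u}{2G\sqrt{-E}}.$$ The surface is a Weingarten surface (W-surface) if there are differentiable functions $f(\nu),g(\nu)$, $\nu\in\mathcal I$ (an interval), with $f-g\ne0$, $f'g'\neq0$, and a function $\nu=\nu(u,v)$ such that $\nu_1=f(\nu)$, $\nu_2=g(\nu)$. Principal parameters $(u,v)$ on a Weingarten surface are natural principal if both functions $\sqrt{-E}\,\exp\left(\int\frac{f'd\nu}{f-g}\right)$ and $\sqrt G\,\exp\left(\int\frac{g'd\nu}{g-f}\right)$ are constant.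
   Formalization: As v → φ(v) keeps all the invariants, uniqueness up to a motion is local at (u0,v0), modulo an increasing change of v; it is pointwise on D0 only for natural principal parameters with equal G at (u0,v0). Naturality of (u,v) is claimed only for the surface constructed. *)

theory Defs
  imports "HOL-Analysis.Analysis" "HOL-Library.Extended_Nat"
begin

section \<open>Functions of class \<open>C\<^sup>k\<close>\<close>

text \<open>The domain is an open set, or an interval of the reals (with one-sided derivatives at
  end points it contains).\<close>

primrec ck_nat :: "nat \<Rightarrow> 'a::euclidean_space set \<Rightarrow> ('a \<Rightarrow> 'b::real_normed_vector) \<Rightarrow> bool" where
  "ck_nat 0 S F \<longleftrightarrow> continuous_on S F"
| "ck_nat (Suc n) S F \<longleftrightarrow> F differentiable_on S \<and>
     (\<forall>b\<in>Basis. ck_nat n S (\<lambda>x. frechet_derivative F (at x within S) b))"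

definition ck :: "enat \<Rightarrow> 'a::euclidean_space set \<Rightarrow> ('a \<Rightarrow> 'b::real_normed_vector) \<Rightarrow> bool" where
  "ck k S F \<longleftrightarrow> (\<forall>n::nat. enat n \<le> k \<longrightarrow> ck_nat n S F)"

definition pd_u :: "(real \<times> real \<Rightarrow> 'b::real_normed_vector) \<Rightarrow> real \<times> real \<Rightarrow> 'b" where
  "pd_u F p = vector_derivative (\<lambda>s. F (s, snd p)) (at (fst p))"

definition pd_v :: "(real \<times> real \<Rightarrow> 'b::real_normed_vector) \<Rightarrow> real \<times> real \<Rightarrow> 'b" where
  "pd_v F p = vector_derivative (\<lambda>s. F (fst p, s)) (at (snd p))"

section \<open>Minkowski 3-space\<close>

definition lor :: "real^3 \<Rightarrow> real^3 \<Rightarrow> real" where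
  "lor x y = x$1 * y$1 + x$2 * y$2 - x$3 * y$3"

text \<open>Motions preserve the orientation of the space. They may reverse the time orientation:
  the sign conventions for the frame of a surface involve only the orientation of the space.\<close>

definition motion :: "(real^3 \<Rightarrow> real^3) \<Rightarrow> bool" where
  "motion T \<longleftrightarrow> (\<exists>(A::real^3^3) b. (\<forall>x y. lor (A *v x) (A *v y) = lor x y) \<and> det A = 1 \<and>
      T = (\<lambda>x. A *v x + b))"

section \<open>Time-like surfaces\<close>

definition E_coef :: "(real \<times> real \<Rightarrow> real^3) \<Rightarrow> real \<times> real \<Rightarrow> real" where
  "E_coef z p = lor (pd_u z p) (pd_u z p)"

definition F_coef :: "(real \<times> real \<Rightarrow> real^3) \<Rightarrow> real \<times> real \<Rightarrow> real" where
  "F_coef z p = lor (pd_u z p) (pd_v z p)"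

definition G_coef :: "(real \<times> real \<Rightarrow> real^3) \<Rightarrow> real \<times> real \<Rightarrow> real" where
  "G_coef z p = lor (pd_v z p) (pd_v z p)"

definition X_frame :: "(real \<times> real \<Rightarrow> real^3) \<Rightarrow> real \<times> real \<Rightarrow> real^3" where
  "X_frame z p = pd_u z p /\<^sub>R sqrt (- E_coef z p)"

definition Y_frame :: "(real \<times> real \<Rightarrow> real^3) \<Rightarrow> real \<times> real \<Rightarrow> real^3" where
  "Y_frame z p = pd_v z p /\<^sub>R sqrt (G_coef z p)"

text \<open>The description is definite wherever \<open>E < 0 < G\<close>: the tangent plane is then
  nondegenerate of signature \<open>(1,1)\<close>.\<close>

definition unit_normal :: "(real \<times> real \<Rightarrow> real^3) \<Rightarrow> real \<times> real \<Rightarrow> real^3" where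
  "unit_normal z p = (THE l. lor l l = 1 \<and> lor l (pd_u z p) = 0 \<and> lor l (pd_v z p) = 0 \<and>
      det (vector [X_frame z p, Y_frame z p, l] :: real^3^3) > 0)"

definition L_coef :: "(real \<times> real \<Rightarrow> real^3) \<Rightarrow> real \<times> real \<Rightarrow> real" where
  "L_coef z p = lor (unit_normal z p) (pd_u (pd_u z) p)"

definition M_coef :: "(real \<times> real \<Rightarrow> real^3) \<Rightarrow> real \<times> real \<Rightarrow> real" where
  "M_coef z p = lor (unit_normal z p) (pd_v (pd_u z) p)"

definition N_coef :: "(real \<times> real \<Rightarrow> real^3) \<Rightarrow> real \<times> real \<Rightarrow> real" where
  "N_coef z p = lor (unit_normal z p) (pd_v (pd_v z) p)"

definition nu1 :: "(real \<times> real \<Rightarrow> real^3) \<Rightarrow> real \<times> real \<Rightarrow> real" where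
  "nu1 z p = L_coef z p / E_coef z p"

definition nu2 :: "(real \<times> real \<Rightarrow> real^3) \<Rightarrow> real \<times> real \<Rightarrow> real" where
  "nu2 z p = N_coef z p / G_coef z p"

definition gamma1 :: "(real \<times> real \<Rightarrow> real^3) \<Rightarrow> real \<times> real \<Rightarrow> real" where
  "gamma1 z p = pd_v (E_coef z) p / (2 * E_coef z p * sqrt (G_coef z p))"

definition gamma2 :: "(real \<times> real \<Rightarrow> real^3) \<Rightarrow> real \<times> real \<Rightarrow> real" where
  "gamma2 z p = - pd_u (G_coef z) p / (2 * G_coef z p * sqrt (- E_coef z p))"

text \<open>Time-like surfaces in principal parameters, with distinct principal curvatures.\<close>

definition timelike_surface :: "enat \<Rightarrow> (real \<times> real) set \<Rightarrow> (real \<times> real \<Rightarrow> real^3) \<Rightarrow> bool" where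
  "timelike_surface k D z \<longleftrightarrow> open D \<and> ck k D z \<and>
     (\<forall>p\<in>D. E_coef z p < 0 \<and> G_coef z p > 0 \<and> F_coef z p = 0 \<and> M_coef z p = 0 \<and>
            nu1 z p \<noteq> nu2 z p)"

section \<open>Weingarten surfaces and natural principal parameters\<close>

definition weingarten_functions ::
  "enat \<Rightarrow> real set \<Rightarrow> (real \<Rightarrow> real) \<Rightarrow> (real \<Rightarrow> real) \<Rightarrow> bool" where
  "weingarten_functions k S f g \<longleftrightarrow> is_interval S \<and> interior S \<noteq> {} \<and> ck k S f \<and> ck k S g \<and>
     (\<forall>x\<in>S. f x - g x \<noteq> 0 \<and>
        vector_derivative f (at x within S) * vector_derivative g (at x within S) \<noteq> 0)"

definition weingarten_with ::
  "enat \<Rightarrow> (real \<times> real) set \<Rightarrow> (real \<times> real \<Rightarrow> real^3) \<Rightarrow>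
   real set \<Rightarrow> (real \<Rightarrow> real) \<Rightarrow> (real \<Rightarrow> real) \<Rightarrow> (real \<times> real \<Rightarrow> real) \<Rightarrow> bool" where
  "weingarten_with k D z S f g \<nu> \<longleftrightarrow> timelike_surface k D z \<and> weingarten_functions k S f g \<and>
     ck k D \<nu> \<and> (\<forall>p\<in>D. \<nu> p \<in> S \<and> nu1 z p = f (\<nu> p) \<and> nu2 z p = g (\<nu> p))"

definition weingarten_surface :: "enat \<Rightarrow> (real \<times> real) set \<Rightarrow> (real \<times> real \<Rightarrow> real^3) \<Rightarrow> bool" where
  "weingarten_surface k D z \<longleftrightarrow> (\<exists>S f g \<nu>. weingarten_with k D z S f g \<nu>)"

text \<open>The oriented integral of \<open>f' / (f - g)\<close> from \<open>c\<close> to \<open>x\<close>.\<close>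

definition W_int ::
  "real set \<Rightarrow> (real \<Rightarrow> real) \<Rightarrow> (real \<Rightarrow> real) \<Rightarrow> real \<Rightarrow> real \<Rightarrow> real" where
  "W_int S f g c x =
     (LBINT t=ereal c..ereal x. vector_derivative f (at t within S) / (f t - g t))"

text \<open>The lower limit \<open>c\<close> of the integrals is immaterial: it changes both functions by
  constant factors.\<close>

definition natural_principal ::
  "enat \<Rightarrow> (real \<times> real) set \<Rightarrow> (real \<times> real \<Rightarrow> real^3) \<Rightarrow>
   real set \<Rightarrow> (real \<Rightarrow> real) \<Rightarrow> (real \<Rightarrow> real) \<Rightarrow> (real \<times> real \<Rightarrow> real) \<Rightarrow> bool" where
  "natural_principal k D z S f g \<nu> \<longleftrightarrow> weingarten_with k D z S f g \<nu> \<and>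
     (\<forall>c\<in>S. (\<lambda>p. sqrt (- E_coef z p) * exp (W_int S f g c (\<nu> p))) constant_on D \<and>
            (\<lambda>p. sqrt (G_coef z p) * exp (W_int S g f c (\<nu> p))) constant_on D)"

definition has_invariants ::
  "(real \<times> real) set \<Rightarrow> (real \<times> real \<Rightarrow> real^3) \<Rightarrow> (real \<times> real \<Rightarrow> real) \<Rightarrow>
   (real \<times> real \<Rightarrow> real) \<Rightarrow> (real \<times> real \<Rightarrow> real) \<Rightarrow> (real \<times> real \<Rightarrow> real) \<Rightarrow> bool" where
  "has_invariants D z n1 n2 c1 c2 \<longleftrightarrow>
     (\<forall>p\<in>D. nu1 z p = n1 p \<and> nu2 z p = n2 p \<and> gamma1 z p = c1 p \<and> gamma2 z p = c2 p)"

text \<open>Two parametrized surfaces present, near \<open>p0\<close>, the same surface up to a motion, with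
  parametrizations that differ at most by an increasing change of the parameter \<open>v\<close> fixing \<open>p0\<close>.
  Such a change affects none of the functions \<open>nu1\<close>, \<open>nu2\<close>, \<open>gamma1\<close>, \<open>gamma2\<close> when
  these depend on \<open>u\<close> alone and \<open>gamma1 = 0\<close>, so that they determine a parametrized surface
  only up to such a change.\<close>

definition congruent_near ::
  "enat \<Rightarrow> real \<times> real \<Rightarrow> (real \<times> real) set \<Rightarrow> (real \<times> real \<Rightarrow> real^3) \<Rightarrow>
   (real \<times> real) set \<Rightarrow> (real \<times> real \<Rightarrow> real^3) \<Rightarrow> bool" where
  "congruent_near k p0 D z D' z' \<longleftrightarrow>
     (\<exists>T \<phi> U. motion T \<and> open U \<and> p0 \<in> U \<and> U \<subseteq> D' \<and>
        ck k (snd ` U) \<phi> \<and> (\<forall>v\<in>snd ` U. deriv \<phi> v > 0) \<and> \<phi> (snd p0) = snd p0 \<and>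
        (\<forall>(u, v)\<in>U. (u, \<phi> v) \<in> D \<and> z' (u, v) = T (z (u, \<phi> v))))"

end

theory Submission
  imports Defs
begin

text \<open>Codazzi's equation, read off from \<open>l\<^sub>u\<^sub>v = l\<^sub>v\<^sub>u\<close>, forces \<open>\<surd>G = c(v) exp (- J)\<close>, and the prescribed
  \<open>\<gamma>\<^sub>2\<close> then gives \<open>\<surd>(- E) = exp (- I) / a\<close>. Hence the frame \<open>X Y l\<close> of any solution satisfies a
  linear system known up to the reparametrization \<open>v \<mapsto> \<integral>c\<close>, and two frames satisfying the same
  system differ by a constant Lorentz map; this is uniqueness.
  For existence put \<open>e = \<surd>(- E)\<close>, \<open>q = \<surd>G\<close>, \<open>h = q'/e\<close> and \<open>n = g q\<close>, taking \<open>c = 1\<close>. The equations of Gauss and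
  Codazzi are \<open>h' = f e n\<close> and \<open>n' = f e h\<close>, so \<open>m = h\<^sup>2 - n\<^sup>2\<close> is constant and \<open>Y\<^sub>v\<^sub>v = m Y\<close>. The solution
  is therefore a surface of revolution whose profile is obtained by quadratures from
  \<open>\<theta> = \<integral>f e\<close>: \<open>z = P(u) e\<^sub>3 - Q(u) e\<^sub>2 + q(u) W(v)\<close> with \<open>P' = e cosh \<theta>\<close>, \<open>Q' = e sinh \<theta>\<close> and \<open>W' = Y\<close>.\<close>

section \<open>Calculus of \<open>C\<^sup>k\<close> functions\<close>

text \<open>The invariants depend on \<open>u\<close> alone and leave \<open>v\<close> free up to an
  increasing change. Uniqueness therefore has two strengths: an arbitrary competitor agrees with the
  model near the base point after such a change, whereas natural principal parameters make
  \<open>sqrt G * exp J\<close> constant, so that the value of \<open>G\<close> at one point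
  excludes any change. The obstacle in the Codazzi step is regularity. The normal \<open>l\<close>
  is built from first derivatives of \<open>z\<close>, so second derivatives of \<open>l\<close> are
  not at hand directly; but the Weingarten formulas exhibit \<open>l_u\<close> and
  \<open>l_v\<close> as multiples of \<open>z_u\<close> and \<open>z_v\<close> by functions of
  \<open>u\<close>, and these can be differentiated once more with continuous results. The form of
  the surface comes from \<open>Y_u = 0\<close>: the vector \<open>Y_v = h X + n l\<close> cannot
  depend on \<open>u\<close>, and this independence is what the equations for \<open>h'\<close> and
  \<open>n'\<close> express. The angle \<open>\<theta>\<close> is the hyperbolic rotation of
  \<open>X\<close> and \<open>l\<close> along a profile. The sign of \<open>m\<close> decides
  whether the axis is spacelike, lightlike or timelike.\<close>

lemma ck_nat_cong:
  assumes "ck_nat n S F" "\<And>x. x \<in> S \<Longrightarrow> F x = G x"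
  shows "ck_nat n S G"
  using assms
proof (induction n arbitrary: F G)
  case 0
  then show ?case using continuous_on_cong by fastforce
next
  case (Suc n)
  \<comment> \<open>\<open>frechet_derivative\<close> is a choice among the derivatives. Both
    functions have the same derivatives within \<open>S\<close>, so the choices agree as
    well.\<close>
  have "frechet_derivative G (at x within S) = frechet_derivative F (at x within S)" if "x \<in> S" for x
  proof -
    have "(G has_derivative D) (at x within S) = (F has_derivative D) (at x within S)" for D
      using Suc.prems(2) that has_derivative_transform[of x S G F D] has_derivative_transform[of x S F G D] by metis
    then show ?thesis by (simp add: frechet_derivative_def)
  qed
  moreover have "G differentiable_on S"
    using Suc.prems differentiable_transform_within[of F _ S 1 G] by (fastforce simp: differentiable_on_def)
  ultimately show ?case using Suc.IH Suc.prems by fastforce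
qed

text \<open>A point of \<open>T\<close> is interior to \<open>S\<close>, so derivatives within
  \<open>S\<close> and within \<open>T\<close> are both ordinary derivatives there, even if
  \<open>S\<close> contains some of its boundary.\<close>

lemma ck_nat_open_subset:
  assumes "ck_nat n S F" "open T" "T \<subseteq> S"
  shows "ck_nat n T F"
  using assms(1)
proof (induction n arbitrary: F)
  case 0
  then show ?case using assms continuous_on_subset by auto
next
  case (Suc n)
  have at: "at x within S = at x within T" if "x \<in> T" for x
    using assms that at_within_interior[of x S] at_within_open[of x T]
      interior_maximal[of T S] by auto
  have "F differentiable_on T"
    using Suc.prems assms(3) differentiable_on_subset by auto
  moreover have "ck_nat n T (\<lambda>x. frechet_derivative F (at x within T) b)" if "b \<in> Basis" for b
    using ck_nat_cong[OF Suc.IH] Suc.prems that at by force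
  ultimately show ?case by auto
qed

text \<open>Derivatives on an open set are unique, so the choice made by
  \<open>frechet_derivative\<close> may be replaced by any explicit derivative. The inductions on
  the order exhibit one through this form.\<close>

lemma ck_nat_Suc_open:
  assumes "open S"
  shows "ck_nat (Suc n) S F \<longleftrightarrow>
    (\<exists>F'. (\<forall>x\<in>S. (F has_derivative F' x) (at x)) \<and> (\<forall>b\<in>Basis. ck_nat n S (\<lambda>x. F' x b)))"
  (is "?L \<longleftrightarrow> ?R")
proof
  assume ?L
  then have "(F has_derivative frechet_derivative F (at x within S)) (at x)" if "x \<in> S" for x
    using that assms frechet_derivative_works[of F "at x within S"] at_within_open[of x S]
    by (auto simp: differentiable_on_def)
  with \<open>?L\<close> show ?R by (intro exI[of _ "\<lambda>x. frechet_derivative F (at x within S)"]) auto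
next
  assume ?R
  then obtain F' where F': "\<And>x. x \<in> S \<Longrightarrow> (F has_derivative F' x) (at x)"
    "\<And>b. b \<in> Basis \<Longrightarrow> ck_nat n S (\<lambda>x. F' x b)" by auto
  have "frechet_derivative F (at x within S) = F' x" if "x \<in> S" for x
    using F'(1)[OF that] that assms at_within_open[of x S] frechet_derivative_at by force
  then have "ck_nat n S (\<lambda>x. frechet_derivative F (at x within S) b)" if "b \<in> Basis" for b
    using ck_nat_cong[OF F'(2)[OF that]] by force
  moreover have "F differentiable_on S"
    using F'(1) differentiable_def differentiable_at_imp_differentiable_on by blast
  ultimately show ?L by auto
qed

lemma ck_nat_Suc_imp:
  assumes "ck_nat (Suc n) S F"
  shows "ck_nat n S F"
  using assms
  by (induction n arbitrary: F) (auto simp: differentiable_imp_continuous_on)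

lemma ck_nat_mono: "ck_nat n S F \<Longrightarrow> m \<le> n \<Longrightarrow> ck_nat m S F"
  by (induction n) (use ck_nat_Suc_imp le_Suc_eq in blast)+

lemma ck_nat_continuous_on: "ck_nat n S F \<Longrightarrow> continuous_on S F"
  using ck_nat_mono[of n S F 0] by simp

lemma ck_nat_const: "open S \<Longrightarrow> ck_nat n S (\<lambda>x. c)"
  by (induction n arbitrary: c) (auto simp: ck_nat_Suc_open simp del: ck_nat.simps(2) intro!: exI[of _ "\<lambda>x h. 0"])

lemma ck_nat_add:
  assumes "open S" "ck_nat n S F" "ck_nat n S G"
  shows "ck_nat n S (\<lambda>x. F x + G x)"
  using assms(2,3)
proof (induction n arbitrary: F G)
  case 0
  then show ?case by (auto intro: continuous_intros)
next
  case (Suc n)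
  from Suc.prems obtain F' G' where
    "\<forall>x\<in>S. (F has_derivative F' x) (at x)" "\<forall>b\<in>Basis. ck_nat n S (\<lambda>x. F' x b)"
    "\<forall>x\<in>S. (G has_derivative G' x) (at x)" "\<forall>b\<in>Basis. ck_nat n S (\<lambda>x. G' x b)"
    unfolding ck_nat_Suc_open[OF assms(1)] by blast
  with Suc.IH show ?case unfolding ck_nat_Suc_open[OF assms(1)]
    by (intro exI[of _ "\<lambda>x h. F' x h + G' x h"]) (auto intro: has_derivative_add)
qed

lemma ck_nat_bounded_linear:
  assumes "bounded_linear f" "open S" "ck_nat n S F"
  shows "ck_nat n S (\<lambda>x. f (F x))"
  using assms(3)
proof (induction n arbitrary: F)
  case 0
  then show ?case using assms(1) by (auto intro: bounded_linear.continuous_on)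
next
  case (Suc n)
  from Suc.prems obtain F' where
    "\<forall>x\<in>S. (F has_derivative F' x) (at x)" "\<forall>b\<in>Basis. ck_nat n S (\<lambda>x. F' x b)"
    unfolding ck_nat_Suc_open[OF assms(2)] by blast
  with Suc.IH show ?case unfolding ck_nat_Suc_open[OF assms(2)]
    by (intro exI[of _ "\<lambda>x h. f (F' x h)"]) (auto intro: bounded_linear.has_derivative[OF assms(1)])
qed

text \<open>The product rule expresses the derivative by two products of the same kind, which closes
  the induction. General bounded bilinear maps cover products of functions, scalings and
  \<open>lor\<close> at once.\<close>

lemma ck_nat_bilinear:
  assumes "bounded_bilinear pr" "open S" "ck_nat n S F" "ck_nat n S G"
  shows "ck_nat n S (\<lambda>x. pr (F x) (G x))"
  using assms(3,4)
proof (induction n arbitrary: F G)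
  case 0
  then show ?case using assms(1) by (auto intro: bounded_bilinear.continuous_on)
next
  case (Suc n)
  from Suc.prems obtain F' G' where FG:
    "\<forall>x\<in>S. (F has_derivative F' x) (at x)" "\<forall>b\<in>Basis. ck_nat n S (\<lambda>x. F' x b)"
    "\<forall>x\<in>S. (G has_derivative G' x) (at x)" "\<forall>b\<in>Basis. ck_nat n S (\<lambda>x. G' x b)"
    unfolding ck_nat_Suc_open[OF assms(2)] by blast
  have "ck_nat n S F" "ck_nat n S G"
    using Suc.prems ck_nat_Suc_imp by blast+
  with FG Suc.IH show ?case unfolding ck_nat_Suc_open[OF assms(2)]
    by (intro exI[of _ "\<lambda>x h. pr (F x) (G' x h) + pr (F' x h) (G x)"])
      (auto intro!: bounded_bilinear.FDERIV[OF assms(1)] ck_nat_add assms(2))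
qed

lemma ck_nat_Suc_real:
  fixes \<phi> :: "real \<Rightarrow> 'b::real_normed_vector"
  assumes "open T"
  shows "ck_nat (Suc n) T \<phi> \<longleftrightarrow>
    (\<exists>\<phi>'. (\<forall>x\<in>T. (\<phi> has_vector_derivative \<phi>' x) (at x)) \<and> ck_nat n T \<phi>')" (is "?L \<longleftrightarrow> ?R")
proof
  assume ?L
  then obtain F' where F': "\<forall>x\<in>T. (\<phi> has_derivative F' x) (at x)" "ck_nat n T (\<lambda>x. F' x 1)"
    unfolding ck_nat_Suc_open[OF assms] by auto
  have "F' x = (\<lambda>h. h *\<^sub>R F' x 1)" if "x \<in> T" for x
  proof
    have "bounded_linear (F' x)" using F'(1) that has_derivative_bounded_linear by blast
    then show "F' x h = h *\<^sub>R F' x 1" for h using linear_simps(5)[of "F' x" h 1] by simp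
  qed
  with F' show ?R by (intro exI[of _ "\<lambda>x. F' x 1"]) (auto simp: has_vector_derivative_def)
next
  assume ?R
  then show ?L unfolding ck_nat_Suc_open[OF assms] has_vector_derivative_def by force
qed

text \<open>As the inner function is real valued, the chain rule gives the scalar
  \<open>\<phi>' x h\<close> times \<open>\<psi>' (\<phi> x)\<close>. The induction hypothesis
  handles the second factor and the bilinear rule the product.\<close>

lemma ck_nat_compose:
  fixes \<phi> :: "'a::euclidean_space \<Rightarrow> real" and \<psi> :: "real \<Rightarrow> 'b::real_normed_vector"
  assumes "open S" "open T" "\<phi> ` S \<subseteq> T" "ck_nat n S \<phi>" "ck_nat n T \<psi>"
  shows "ck_nat n S (\<lambda>x. \<psi> (\<phi> x))"
  using assms(4,5)
proof (induction n arbitrary: \<psi>)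
  case 0
  then show ?case using assms(3) by (auto intro: continuous_on_compose2)
next
  case (Suc n)
  obtain \<phi>' where \<phi>': "\<forall>x\<in>S. (\<phi> has_derivative \<phi>' x) (at x)" "\<forall>b\<in>Basis. ck_nat n S (\<lambda>x. \<phi>' x b)"
    using Suc.prems(1) unfolding ck_nat_Suc_open[OF assms(1)] by blast
  obtain \<psi>' where \<psi>': "\<forall>x\<in>T. (\<psi> has_vector_derivative \<psi>' x) (at x)" "ck_nat n T \<psi>'"
    using Suc.prems(2) unfolding ck_nat_Suc_real[OF assms(2)] by blast
  have "ck_nat n S \<phi>" using Suc.prems ck_nat_Suc_imp by blast
  then have "ck_nat n S (\<lambda>x. \<psi>' (\<phi> x))" using Suc.IH \<psi>'(2) by blast
  moreover have "((\<lambda>x. \<psi> (\<phi> x)) has_derivative (\<lambda>h. \<phi>' x h *\<^sub>R \<psi>' (\<phi> x))) (at x)" if "x \<in> S" for x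
    using diff_chain_at[of \<phi> "\<phi>' x" x \<psi> "\<lambda>h. h *\<^sub>R \<psi>' (\<phi> x)"] that \<phi>' \<psi>' assms(3)
    by (auto simp: o_def has_vector_derivative_def)
  ultimately show ?case unfolding ck_nat_Suc_open[OF assms(1)] using \<phi>'(2)
    by (intro exI[of _ "\<lambda>x h. \<phi>' x h *\<^sub>R \<psi>' (\<phi> x)"])
      (auto intro!: ck_nat_bilinear[OF bounded_bilinear_scaleR] assms(1))
qed

lemma ck_nat_id: "open S \<Longrightarrow> ck_nat n S (\<lambda>x. x)"
  by (cases n) (auto simp: ck_nat_Suc_open continuous_on_id simp del: ck_nat.simps(2)
    intro!: exI[of _ "\<lambda>x h. h"] ck_nat_const)

section \<open>Smoothness of the exponential, the inverse and the square root\<close>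

lemma ck_nat_exp: "ck_nat n UNIV (exp :: real \<Rightarrow> real)"
proof (induction n)
  case (Suc n)
  then show ?case unfolding ck_nat_Suc_real[OF open_UNIV]
    using DERIV_exp has_real_derivative_iff_has_vector_derivative by blast
qed (simp add: continuous_on_exp)

text \<open>The derivative is minus the square of the function itself, so each order follows from
  the previous one. Denominators of unknown sign are squared before this is applied.\<close>

lemma ck_nat_inverse: "ck_nat n {0<..} (inverse :: real \<Rightarrow> real)"
proof (induction n)
  case (Suc n)
  have "(inverse has_vector_derivative - (inverse x * inverse x)) (at x)" if "x > 0" for x :: real
    using DERIV_inverse[of x] that
    by (simp add: has_real_derivative_iff_has_vector_derivative power2_eq_square numeral_2_eq_2)
  moreover have "ck_nat n {0<..} (\<lambda>x::real. - (inverse x * inverse x))"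
    by (intro ck_nat_bounded_linear[OF bounded_linear_minus[OF bounded_linear_ident]]
      ck_nat_bilinear[OF bounded_bilinear_mult] Suc open_greaterThan)
  ultimately show ?case unfolding ck_nat_Suc_real[OF open_greaterThan]
    by (intro exI[of _ "\<lambda>x. - (inverse x * inverse x)"]) simp
qed (simp add: continuous_on_inverse)

lemma ck_nat_sqrt: "ck_nat n {0<..} (sqrt :: real \<Rightarrow> real)"
proof (induction n)
  case (Suc n)
  have "(sqrt has_vector_derivative (1/2) * inverse (sqrt x)) (at x)" if "x > 0" for x :: real
    using DERIV_real_sqrt[OF that]
    by (simp add: has_real_derivative_iff_has_vector_derivative mult.commute)
  moreover have "ck_nat n {0<..} (\<lambda>x::real. (1/2) * inverse (sqrt x))"
    by (intro ck_nat_bilinear[OF bounded_bilinear_mult] ck_nat_const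
      ck_nat_compose[OF _ _ _ Suc ck_nat_inverse] open_greaterThan) auto
  ultimately show ?case unfolding ck_nat_Suc_real[OF open_greaterThan]
    by (intro exI[of _ "\<lambda>x. (1/2) * inverse (sqrt x)"]) simp
qed (simp add: continuous_on_real_sqrt)

section \<open>Partial derivatives\<close>

text \<open>\<open>pd_u\<close> has an unspecified value where no derivative exists. The relation
  asserts existence and value together, so that derivative rules can be chained.\<close>

definition has_pd_u :: "(real \<times> real \<Rightarrow> 'b::real_normed_vector) \<Rightarrow> 'b \<Rightarrow> real \<times> real \<Rightarrow> bool" where
  "has_pd_u F d p \<longleftrightarrow> ((\<lambda>s. F (s, snd p)) has_vector_derivative d) (at (fst p))"

definition has_pd_v :: "(real \<times> real \<Rightarrow> 'b::real_normed_vector) \<Rightarrow> 'b \<Rightarrow> real \<times> real \<Rightarrow> bool" where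
  "has_pd_v F d p \<longleftrightarrow> ((\<lambda>s. F (fst p, s)) has_vector_derivative d) (at (snd p))"

lemma pd_u_eqI: "has_pd_u F d p \<Longrightarrow> pd_u F p = d"
  by (simp add: has_pd_u_def pd_u_def vector_derivative_at)

lemma pd_v_eqI: "has_pd_v F d p \<Longrightarrow> pd_v F p = d"
  by (simp add: has_pd_v_def pd_v_def vector_derivative_at)

lemma has_pd_u_unique: "has_pd_u F d p \<Longrightarrow> has_pd_u F d' p \<Longrightarrow> d = d'"
  using pd_u_eqI by metis

lemma has_pd_v_unique: "has_pd_v F d p \<Longrightarrow> has_pd_v F d' p \<Longrightarrow> d = d'"
  using pd_v_eqI by metis

lemma has_pd_u_cong:
  assumes "open R" "p \<in> R" "\<And>q. q \<in> R \<Longrightarrow> F q = G q" "has_pd_u F d p"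
  shows "has_pd_u G d p"
proof -
  have "open ((\<lambda>s. (s, snd p)) -` R)"
    using assms(1) by (intro open_vimage continuous_intros)
  then show ?thesis using assms unfolding has_pd_u_def using has_vector_derivative_transform_within_open[of "\<lambda>s. F (s, snd p)" d "fst p" "(\<lambda>s. (s, snd p)) -` R" "\<lambda>s. G (s, snd p)"]
    by auto
qed

lemma has_pd_v_cong:
  assumes "open R" "p \<in> R" "\<And>q. q \<in> R \<Longrightarrow> F q = G q" "has_pd_v F d p"
  shows "has_pd_v G d p"
proof -
  have "open ((\<lambda>s. (fst p, s)) -` R)"
    using assms(1) by (intro open_vimage continuous_intros)
  then show ?thesis using assms unfolding has_pd_v_def
    using has_vector_derivative_transform_within_open[of "\<lambda>s. F (fst p, s)" d "snd p" "(\<lambda>s. (fst p, s)) -` R" "\<lambda>s. G (fst p, s)"]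
    by auto
qed

lemma has_pd_u_const: "has_pd_u (\<lambda>q. c) 0 p"
  by (simp add: has_pd_u_def)

lemma has_pd_v_const: "has_pd_v (\<lambda>q. c) 0 p"
  by (simp add: has_pd_v_def)

lemma has_pd_u_bilinear:
  assumes "bounded_bilinear pr" "has_pd_u F F' p" "has_pd_u G G' p"
  shows "has_pd_u (\<lambda>q. pr (F q) (G q)) (pr (F p) G' + pr F' (G p)) p"
  using bounded_bilinear.has_vector_derivative[OF assms(1)] assms(2,3)
  unfolding has_pd_u_def by fastforce

lemma has_pd_v_bilinear:
  assumes "bounded_bilinear pr" "has_pd_v F F' p" "has_pd_v G G' p"
  shows "has_pd_v (\<lambda>q. pr (F q) (G q)) (pr (F p) G' + pr F' (G p)) p"
  using bounded_bilinear.has_vector_derivative[OF assms(1)] assms(2,3)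
  unfolding has_pd_v_def by fastforce

lemmas has_pd_u_scaleR = has_pd_u_bilinear[OF bounded_bilinear_scaleR]
lemmas has_pd_v_scaleR = has_pd_v_bilinear[OF bounded_bilinear_scaleR]

lemma has_pd_u_add: "has_pd_u F F' p \<Longrightarrow> has_pd_u G G' p \<Longrightarrow> has_pd_u (\<lambda>q. F q + G q) (F' + G') p"
  unfolding has_pd_u_def by (rule has_vector_derivative_add)

lemma has_pd_v_add: "has_pd_v F F' p \<Longrightarrow> has_pd_v G G' p \<Longrightarrow> has_pd_v (\<lambda>q. F q + G q) (F' + G') p"
  unfolding has_pd_v_def by (rule has_vector_derivative_add)

lemma has_pd_u_diff: "has_pd_u F F' p \<Longrightarrow> has_pd_u G G' p \<Longrightarrow> has_pd_u (\<lambda>q. F q - G q) (F' - G') p"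
  unfolding has_pd_u_def by (rule has_vector_derivative_diff)

lemma has_pd_v_diff: "has_pd_v F F' p \<Longrightarrow> has_pd_v G G' p \<Longrightarrow> has_pd_v (\<lambda>q. F q - G q) (F' - G') p"
  unfolding has_pd_v_def by (rule has_vector_derivative_diff)

lemma has_pd_u_fst:
  "(\<phi> has_vector_derivative d) (at (fst p)) \<Longrightarrow> has_pd_u (\<lambda>q. \<phi> (fst q)) d p"
  by (simp add: has_pd_u_def)

lemma has_pd_v_fst: "has_pd_v (\<lambda>q. \<phi> (fst q)) 0 p"
  by (simp add: has_pd_v_def)

lemma has_pd_u_snd: "has_pd_u (\<lambda>q. \<phi> (snd q)) 0 p"
  by (simp add: has_pd_u_def)

lemma has_pd_v_snd:
  "(\<phi> has_vector_derivative d) (at (snd p)) \<Longrightarrow> has_pd_v (\<lambda>q. \<phi> (snd q)) d p"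
  by (simp add: has_pd_v_def)

text \<open>Two points of the box are joined by a segment in the \<open>u\<close> direction followed
  by one in the \<open>v\<close> direction, and \<open>F\<close> is constant on each.\<close>

lemma zero_pd_constant:
  fixes F :: "real \<times> real \<Rightarrow> 'b::real_normed_vector"
  assumes "convex A" "convex B"
    and "\<And>p. p \<in> A \<times> B \<Longrightarrow> has_pd_u F 0 p" "\<And>p. p \<in> A \<times> B \<Longrightarrow> has_pd_v F 0 p"
    and "p \<in> A \<times> B" "q \<in> A \<times> B"
  shows "F p = F q"
proof -
  obtain u v u' v' where pq: "p = (u, v)" "q = (u', v')" "u \<in> A" "u' \<in> A" "v \<in> B" "v' \<in> B"
    using assms(5,6) by auto
  have "((\<lambda>s. F (s, v)) has_vector_derivative 0) (at s within A)" if "s \<in> A" for s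
    using assms(3)[of "(s, v)"] that pq by (auto simp: has_pd_u_def intro: has_vector_derivative_at_within)
  then obtain c where "\<And>s. s \<in> A \<Longrightarrow> F (s, v) = c"
    using has_vector_derivative_zero_constant[OF assms(1)] by metis
  moreover have "((\<lambda>s. F (u', s)) has_vector_derivative 0) (at s within B)" if "s \<in> B" for s
    using assms(4)[of "(u', s)"] that pq by (auto simp: has_pd_v_def intro: has_vector_derivative_at_within)
  then obtain d where "\<And>s. s \<in> B \<Longrightarrow> F (u', s) = d"
    using has_vector_derivative_zero_constant[OF assms(2)] by metis
  ultimately show ?thesis using pq by metis
qed

text \<open>The second difference of \<open>F\<close> over a small square, divided by the area, is a
  value of \<open>A\<close> by two applications of the mean value theorem, and a value of
  \<open>B\<close> when the variables are taken in the other order. Continuity at \<open>p\<close>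
  forces the two limits to agree. Phrased with partial derivatives alone, this can be applied to the
  unit normal.\<close>

lemma mixed_pd_eq_real:
  fixes F :: "real \<times> real \<Rightarrow> real"
  assumes "open R" "p \<in> R"
    and Fu: "\<And>q. q \<in> R \<Longrightarrow> has_pd_u F (Fu q) q" and Fv: "\<And>q. q \<in> R \<Longrightarrow> has_pd_v F (Fv q) q"
    and A: "\<And>q. q \<in> R \<Longrightarrow> has_pd_v Fu (A q) q" and B: "\<And>q. q \<in> R \<Longrightarrow> has_pd_u Fv (B q) q"
    and cont: "continuous_on R A" "continuous_on R B"
  shows "A p = B p"
proof (rule ccontr)
  assume "A p \<noteq> B p"
  define \<epsilon> where "\<epsilon> = dist (A p) (B p) / 2"
  have "\<epsilon> > 0" using \<open>A p \<noteq> B p\<close> by (simp add: \<epsilon>_def)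
  have "isCont A p" "isCont B p"
    using assms(1,2) cont continuous_on_eq_continuous_at by blast+
  then obtain d1 d2 where d: "d1 > 0" "d2 > 0"
    "\<And>q. dist q p < d1 \<Longrightarrow> dist (A q) (A p) < \<epsilon>" "\<And>q. dist q p < d2 \<Longrightarrow> dist (B q) (B p) < \<epsilon>"
    using \<open>\<epsilon> > 0\<close> unfolding continuous_at_eps_delta by metis
  obtain d3 where d3: "d3 > 0" "\<And>q. dist q p < d3 \<Longrightarrow> q \<in> R"
    using assms(1,2) open_dist by blast
  \<comment> \<open>Points of the square of side \<open>h\<close> have distance at most
    \<open>2 * h\<close> from \<open>p\<close>, hence less than \<open>3 * h\<close>, which exceeds
    none of the three radii.\<close>
  define h where "h = min d1 (min d2 d3) / 3"
  have h: "h > 0" "3 * h \<le> d1" "3 * h \<le> d2" "3 * h \<le> d3"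
    using d d3 by (auto simp: h_def)
  obtain u v where p: "p = (u, v)" by force
  have near: "dist (s, t) p < 3 * h" if "u \<le> s" "s \<le> u + h" "v \<le> t" "t \<le> v + h" for s t
  proof -
    have "dist (s, t) p \<le> \<bar>s - u\<bar> + \<bar>t - v\<bar>"
      using sqrt_sum_squares_le_sum_abs[of "s - u" "t - v"]
      by (simp add: p dist_Pair_Pair dist_real_def)
    then show ?thesis using that h by linarith
  qed
  have R: "(s, t) \<in> R" if "u \<le> s" "s \<le> u + h" "v \<le> t" "t \<le> v + h" for s t
    using near[OF that] d3(2) h(4) by fastforce
  define \<Delta> where "\<Delta> = F (u + h, v + h) - F (u + h, v) - F (u, v + h) + F (u, v)"
  have "\<exists>s>u. s < u + h \<and> (F (u + h, v + h) - F (u + h, v)) - (F (u, v + h) - F (u, v))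
      = (u + h - u) * (Fu (s, v + h) - Fu (s, v))"
    using h(1) Fu[OF R]
    by (intro MVT2[of u "u + h" "\<lambda>s. F (s, v + h) - F (s, v)"]) (auto simp: has_pd_u_def has_real_derivative_iff_has_vector_derivative
        intro!: has_vector_derivative_diff)
  then obtain s where s: "u < s" "s < u + h" "\<Delta> = h * (Fu (s, v + h) - Fu (s, v))"
    by (auto simp: \<Delta>_def algebra_simps)
  have "\<exists>t>v. t < v + h \<and> Fu (s, v + h) - Fu (s, v) = (v + h - v) * A (s, t)"
    using h(1) s A[OF R]
    by (intro MVT2[of v "v + h" "\<lambda>t. Fu (s, t)"]) (auto simp: has_pd_v_def has_real_derivative_iff_has_vector_derivative)
  then obtain t where t: "v < t" "t < v + h" "\<Delta> = h * (h * A (s, t))"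
    using s by auto
  have "\<exists>t'>v. t' < v + h \<and> (F (u + h, v + h) - F (u, v + h)) - (F (u + h, v) - F (u, v))
      = (v + h - v) * (Fv (u + h, t') - Fv (u, t'))"
    using h(1) Fv[OF R]
    by (intro MVT2[of v "v + h" "\<lambda>t. F (u + h, t) - F (u, t)"]) (auto simp: has_pd_v_def has_real_derivative_iff_has_vector_derivative
        intro!: has_vector_derivative_diff)
  then obtain t' where t': "v < t'" "t' < v + h" "\<Delta> = h * (Fv (u + h, t') - Fv (u, t'))"
    by (auto simp: \<Delta>_def algebra_simps)
  have "\<exists>s'>u. s' < u + h \<and> Fv (u + h, t') - Fv (u, t') = (u + h - u) * B (s', t')"
    using h(1) t' B[OF R]
    by (intro MVT2[of u "u + h" "\<lambda>s. Fv (s, t')"]) (auto simp: has_pd_u_def has_real_derivative_iff_has_vector_derivative)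
  then obtain s' where s': "u < s'" "s' < u + h" "\<Delta> = h * (h * B (s', t'))"
    using t' by auto
  have "A (s, t) = B (s', t')" using t(3) s'(3) h(1) by simp
  moreover have "dist (A (s, t)) (A p) < \<epsilon>" "dist (B (s', t')) (B p) < \<epsilon>"
    using d(3)[of "(s, t)"] d(4)[of "(s', t')"] near[of s t] near[of s' t'] s t s' t' h by auto
  ultimately show False
    using dist_triangle_half_r[of "A (s,t)" "A p" "2 * \<epsilon>" "B p"] unfolding \<epsilon>_def by simp
qed

lemma mixed_pd_eq:
  fixes F :: "real \<times> real \<Rightarrow> 'b::euclidean_space"
  assumes "open R" "p \<in> R"
    and "\<And>q. q \<in> R \<Longrightarrow> has_pd_u F (Fu q) q" "\<And>q. q \<in> R \<Longrightarrow> has_pd_v F (Fv q) q"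
    and "\<And>q. q \<in> R \<Longrightarrow> has_pd_v Fu (A q) q" "\<And>q. q \<in> R \<Longrightarrow> has_pd_u Fv (B q) q"
    and "continuous_on R A" "continuous_on R B"
  shows "A p = B p"
proof (rule euclidean_eqI)
  fix b :: 'b
  have "has_pd_u (\<lambda>q. G q \<bullet> b) (d \<bullet> b) q" if "has_pd_u G d q" for G d q
    using that bounded_linear.has_vector_derivative[OF bounded_linear_inner_left]
    unfolding has_pd_u_def by blast
  moreover have "has_pd_v (\<lambda>q. G q \<bullet> b) (d \<bullet> b) q" if "has_pd_v G d q" for G d q
    using that bounded_linear.has_vector_derivative[OF bounded_linear_inner_left]
    unfolding has_pd_v_def by blast
  ultimately show "A p \<bullet> b = B p \<bullet> b"
    using assms by (intro mixed_pd_eq_real[of R p "\<lambda>q. F q \<bullet> b" "\<lambda>q. Fu q \<bullet> b" "\<lambda>q. Fv q \<bullet> b"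
        "\<lambda>q. A q \<bullet> b" "\<lambda>q. B q \<bullet> b"]) (auto intro: continuous_intros)
qed

text \<open>The partial derivatives are the values of the Frechet derivative at
  \<open>(1, 0)\<close> and \<open>(0, 1)\<close>, which are elements of \<open>Basis\<close>; so
  they inherit its smoothness.\<close>

lemma ck_nat_pd:
  assumes "open D" "ck_nat (Suc n) D F"
  shows "ck_nat n D (pd_u F)" "ck_nat n D (pd_v F)"
    and "p \<in> D \<Longrightarrow> has_pd_u F (pd_u F p) p" "p \<in> D \<Longrightarrow> has_pd_v F (pd_v F p) p"
proof -
  obtain F' where F': "\<And>x. x \<in> D \<Longrightarrow> (F has_derivative F' x) (at x)"
    "\<And>b. b \<in> Basis \<Longrightarrow> ck_nat n D (\<lambda>x. F' x b)"
    using assms unfolding ck_nat_Suc_open[OF assms(1)] by blast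
  have lin: "F' p (t *\<^sub>R w) = t *\<^sub>R F' p w" if "p \<in> D" for p t w
    using F'(1)[OF that] has_derivative_bounded_linear linear_simps(5) by blast
  have u: "has_pd_u F (F' p (1, 0)) p" if "p \<in> D" for p
  proof -
    have "((\<lambda>s. F (s, snd p)) has_derivative (\<lambda>h. F' p (h, 0))) (at (fst p))"
      using F'(1)[OF that]
      by (intro has_derivative_compose[of "\<lambda>s. (s, snd p)" "\<lambda>h. (h, 0)" "fst p" UNIV F "F' p"])
        (auto intro!: derivative_eq_intros)
    moreover have "(\<lambda>h. F' p (h, 0)) = (\<lambda>h. h *\<^sub>R F' p (1, 0))"
    proof
      show "F' p (h, 0) = h *\<^sub>R F' p (1, 0)" for h
        using lin[OF that, of h "(1, 0)"] by simp
    qed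
    ultimately show ?thesis unfolding has_pd_u_def has_vector_derivative_def by (simp only:)
  qed
  have v: "has_pd_v F (F' p (0, 1)) p" if "p \<in> D" for p
  proof -
    have "((\<lambda>s. F (fst p, s)) has_derivative (\<lambda>h. F' p (0, h))) (at (snd p))"
      using F'(1)[OF that]
      by (intro has_derivative_compose[of "\<lambda>s. (fst p, s)" "\<lambda>h. (0, h)" "snd p" UNIV F "F' p"])
        (auto intro!: derivative_eq_intros)
    moreover have "(\<lambda>h. F' p (0, h)) = (\<lambda>h. h *\<^sub>R F' p (0, 1))"
    proof
      show "F' p (0, h) = h *\<^sub>R F' p (0, 1)" for h
        using lin[OF that, of h "(0, 1)"] by simp
    qed
    ultimately show ?thesis unfolding has_pd_v_def has_vector_derivative_def by (simp only:)
  qed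
  have "(1, 0) \<in> (Basis :: (real \<times> real) set)" "(0, 1) \<in> (Basis :: (real \<times> real) set)"
    by (auto simp: Basis_prod_def)
  then show "ck_nat n D (pd_u F)" "ck_nat n D (pd_v F)"
    using ck_nat_cong[OF F'(2), of _ _] u v pd_u_eqI pd_v_eqI by metis+
  show "p \<in> D \<Longrightarrow> has_pd_u F (pd_u F p) p" "p \<in> D \<Longrightarrow> has_pd_v F (pd_v F p) p"
    using u v pd_u_eqI pd_v_eqI by metis+
qed

lemma ck_nat_slice:
  fixes F :: "real \<times> real \<Rightarrow> 'b::real_normed_vector"
  assumes "open D" "open B" "{u} \<times> B \<subseteq> D" "ck_nat n D F"
  shows "ck_nat n B (\<lambda>v. F (u, v))"
  using assms(4)
proof (induction n arbitrary: F)
  case 0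
  then show ?case using assms(3) by (auto intro!: continuous_on_compose2[of D F B] continuous_intros)
next
  case (Suc n)
  have "ck_nat n B (\<lambda>v. pd_v F (u, v))"
    using Suc ck_nat_pd[OF assms(1)] by blast
  moreover have "((\<lambda>v. F (u, v)) has_vector_derivative pd_v F (u, v)) (at v)" if "v \<in> B" for v
    using ck_nat_pd(4)[OF assms(1) Suc.prems, of "(u, v)"] that assms(3) by (auto simp: has_pd_v_def)
  ultimately show ?case unfolding ck_nat_Suc_real[OF assms(2)]
    by (intro exI[of _ "\<lambda>v. pd_v F (u, v)"]) simp
qed

section \<open>Lorentz algebra\<close>

lemma bounded_bilinear_lor: "bounded_bilinear lor"
proof -
  have "bilinear lor"
    by (auto simp: bilinear_def lor_def algebra_simps intro!: linearI)
  then show ?thesis by (simp add: bilinear_conv_bounded_bilinear)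
qed

interpretation lor: bounded_bilinear lor by (rule bounded_bilinear_lor)

lemma lor_commute: "lor x y = lor y x"
  by (simp add: lor_def algebra_simps)

text \<open>The Euclidean cross product with its third component negated. This is what makes
  \<open>lor (lcross x y) w\<close> the determinant of \<open>x\<close>, \<open>y\<close>,
  \<open>w\<close>.\<close>

definition lcross :: "real^3 \<Rightarrow> real^3 \<Rightarrow> real^3" where
  "lcross x y = vector [x$2 * y$3 - x$3 * y$2, x$3 * y$1 - x$1 * y$3, x$2 * y$1 - x$1 * y$2]"

lemma bounded_bilinear_lcross: "bounded_bilinear lcross"
proof -
  have "bilinear lcross"
    by (auto simp: bilinear_def lcross_def vec_eq_iff forall_3 algebra_simps intro!: linearI)
  then show ?thesis by (simp add: bilinear_conv_bounded_bilinear)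
qed

definition lorentz_frame :: "real^3 \<Rightarrow> real^3 \<Rightarrow> real^3 \<Rightarrow> bool" where
  "lorentz_frame X Y l \<longleftrightarrow> lor X X = -1 \<and> lor Y Y = 1 \<and> lor l l = 1 \<and>
     lor X Y = 0 \<and> lor X l = 0 \<and> lor Y l = 0 \<and> det (vector [X, Y, l] :: real^3^3) > 0"

lemma lorentz_frame_gram:
  assumes "lorentz_frame X Y l"
  shows "lor X X = -1" "lor Y Y = 1" "lor l l = 1" "lor X Y = 0" "lor X l = 0" "lor Y l = 0"
    "lor Y X = 0" "lor l X = 0" "lor l Y = 0"
  using assms lor_commute by (auto simp: lorentz_frame_def)

text \<open>The Gram determinant is the squared determinant times the determinant -1 of the metric;
  hence the leading sign.\<close>

lemma gram_det:
  fixes X Y l :: "real^3"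
  shows "(det (vector [X, Y, l] :: real^3^3))\<^sup>2 =
    - (lor X X * (lor Y Y * lor l l - lor Y l * lor l Y)
       - lor X Y * (lor Y X * lor l l - lor Y l * lor l X)
       + lor X l * (lor Y X * lor l Y - lor Y Y * lor l X))"
  by (simp add: det_3 lor_def) algebra

lemma lorentz_frame_det:
  assumes "lorentz_frame X Y l"
  shows "det (vector [X, Y, l] :: real^3^3) = 1"
proof -
  have "(det (vector [X, Y, l] :: real^3^3))\<^sup>2 = 1"
    unfolding gram_det lorentz_frame_gram[OF assms] by simp
  then show ?thesis using assms unfolding lorentz_frame_def power2_eq_1_iff by linarith
qed

lemma lcross_orthogonal: "lor (lcross x y) x = 0" "lor (lcross x y) y = 0"
  by (simp_all add: lor_def lcross_def algebra_simps)

lemma lor_lcross: "lor (lcross x y) w = det (vector [x, y, w] :: real^3^3)"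
  by (simp add: lor_def lcross_def det_3 algebra_simps)

lemma lor_lcross_self: "lor (lcross x y) (lcross x y) = (lor x y)\<^sup>2 - lor x x * lor y y"
  by (simp add: lor_def lcross_def power2_eq_square algebra_simps)

lemma lorentz_frame_lcross:
  assumes "lor X X = -1" "lor Y Y = 1" "lor X Y = 0"
  shows "lorentz_frame X Y (lcross X Y)"
  using assms lor_lcross_self[of X Y] lor_lcross[of X Y "lcross X Y"] lcross_orthogonal[of X Y]
  by (simp add: lorentz_frame_def lor_commute)

text \<open>Cramer's rule, with the cofactors written as Lorentz cross products.\<close>

lemma cramer_lor:
  fixes X Y l w :: "real^3"
  shows "det (vector [X, Y, l] :: real^3^3) *\<^sub>R w =
    lor (lcross Y l) w *\<^sub>R X + lor (lcross l X) w *\<^sub>R Y + lor (lcross X Y) w *\<^sub>R l"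
  by (simp add: lor_lcross det_3 vec_eq_iff forall_3 algebra_simps)

text \<open>Expanding \<open>lcross X Y\<close> by Cramer's rule, the Lagrange identities give the
  coefficients 0, 0 and 1. So the normal is a function of \<open>X\<close> and \<open>Y\<close>:
  this settles its uniqueness and allows it to be differentiated.\<close>

lemma lorentz_frame_normal:
  assumes "lorentz_frame X Y l"
  shows "lcross X Y = l"
proof -
  let ?d = "lcross X Y - l"
  have 1: "det (vector [X, Y, l] :: real^3^3) = 1" using lorentz_frame_det assms by blast
  have "lcross X Y = lor (lcross Y l) (lcross X Y) *\<^sub>R X + lor (lcross l X) (lcross X Y) *\<^sub>R Y + lor (lcross X Y) (lcross X Y) *\<^sub>R l"
    using cramer_lor[of X Y l "lcross X Y"] 1 by simp
  moreover have "lor (lcross Y l) (lcross X Y) = lor X l * lor Y Y - lor X Y * lor l Y"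
    by (simp add: lor_def lcross_def algebra_simps)
  moreover have "lor (lcross l X) (lcross X Y) = lor X X * lor l Y - lor X Y * lor l X"
    by (simp add: lor_def lcross_def algebra_simps)
  ultimately show ?thesis
    using lor_lcross_self[of X Y] lorentz_frame_gram[OF assms] by simp
qed

text \<open>The minus sign belongs to the time-like \<open>X\<close>. The difference of the two
  sides is orthogonal to the frame; Cramer's rule places it in the span of \<open>X\<close> and
  \<open>Y\<close>, where orthogonality makes it vanish.\<close>

lemma lorentz_frame_expand:
  assumes "lorentz_frame X Y l"
  shows "w = - lor X w *\<^sub>R X + lor Y w *\<^sub>R Y + lor l w *\<^sub>R l"
proof -
  define w' where "w' = w - (- lor X w *\<^sub>R X + lor Y w *\<^sub>R Y + lor l w *\<^sub>R l)"
  note g = lorentz_frame_gram[OF assms]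
  have 0: "lor X w' = 0" "lor Y w' = 0" "lor l w' = 0"
    by (simp_all add: w'_def lor.add_right lor.diff_right lor.scaleR_right lor.minus_right g)
  have "w' = lor (lcross Y l) w' *\<^sub>R X + lor (lcross l X) w' *\<^sub>R Y + lor l w' *\<^sub>R l"
    using cramer_lor[of X Y l w'] lorentz_frame_det[OF assms] lorentz_frame_normal[OF assms] by simp
  then obtain a b where ab: "w' = a *\<^sub>R X + b *\<^sub>R Y"
    using 0(3) by simp
  have "lor X w' = - a" "lor Y w' = b"
    by (simp_all add: ab lor.add_right lor.scaleR_right g)
  then have "w' = 0" using ab 0 by simp
  then show ?thesis by (simp add: w'_def)
qed

text \<open>Any vector meeting the description completes \<open>X_frame\<close> and
  \<open>Y_frame\<close> to a Lorentz frame, and the third vector of such a frame is the cross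
  product of the other two.\<close>

lemma unit_normal_eq:
  assumes "E_coef z p < 0" "G_coef z p > 0" "lorentz_frame (X_frame z p) (Y_frame z p) l"
  shows "unit_normal z p = l"
  unfolding unit_normal_def
proof (rule the_equality)
  have s: "pd_u z p = sqrt (- E_coef z p) *\<^sub>R X_frame z p" "pd_v z p = sqrt (G_coef z p) *\<^sub>R Y_frame z p"
    using assms(1,2) by (auto simp: X_frame_def Y_frame_def)
  show "lor l l = 1 \<and> lor l (pd_u z p) = 0 \<and> lor l (pd_v z p) = 0 \<and>
      det (vector [X_frame z p, Y_frame z p, l] :: real^3^3) > 0"
    using lorentz_frame_gram[OF assms(3)] assms(3) unfolding s
    by (simp add: lor.scaleR_right lorentz_frame_def)
  fix l'
  assume l': "lor l' l' = 1 \<and> lor l' (pd_u z p) = 0 \<and> lor l' (pd_v z p) = 0 \<and>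
      det (vector [X_frame z p, Y_frame z p, l'] :: real^3^3) > 0"
  then have "lorentz_frame (X_frame z p) (Y_frame z p) l'"
    using lorentz_frame_gram[OF assms(3)] assms(1,2)
    by (auto simp: lorentz_frame_def lor_commute X_frame_def Y_frame_def lor.scaleR_right lor.scaleR_left)
  then show "l' = l" using lorentz_frame_normal assms(3) by metis
qed

section \<open>Adapted frames\<close>

text \<open>Here \<open>\<alpha> = \<surd>(- E)\<close>, \<open>\<beta> = \<surd>G\<close>, \<open>\<eta> = - \<surd>G \<gamma>\<^sub>2\<close>, \<open>\<kappa> = - \<surd>(- E) \<nu>\<^sub>1\<close>, \<open>\<omega> = \<surd>G \<nu>\<^sub>2\<close>, and \<open>\<gamma>\<^sub>1 = 0\<close>.\<close>

definition adapted_frame where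
  "adapted_frame R \<alpha> \<beta> \<eta> \<kappa> \<omega> z X Y l \<longleftrightarrow>
    (\<forall>p\<in>R. lorentz_frame (X p) (Y p) (l p) \<and>
      has_pd_u z (\<alpha> p *\<^sub>R X p) p \<and> has_pd_v z (\<beta> p *\<^sub>R Y p) p \<and>
      has_pd_u X (\<kappa> p *\<^sub>R l p) p \<and> has_pd_v X (\<eta> p *\<^sub>R Y p) p \<and>
      has_pd_u Y 0 p \<and> has_pd_v Y (\<eta> p *\<^sub>R X p + \<omega> p *\<^sub>R l p) p \<and>
      has_pd_u l (\<kappa> p *\<^sub>R X p) p \<and> has_pd_v l (- \<omega> p *\<^sub>R Y p) p)"

lemma adapted_frameD:
  assumes "adapted_frame R \<alpha> \<beta> \<eta> \<kappa> \<omega> z X Y l" "p \<in> R"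
  shows "lorentz_frame (X p) (Y p) (l p)"
    "has_pd_u z (\<alpha> p *\<^sub>R X p) p" "has_pd_v z (\<beta> p *\<^sub>R Y p) p"
    "has_pd_u X (\<kappa> p *\<^sub>R l p) p" "has_pd_v X (\<eta> p *\<^sub>R Y p) p"
    "has_pd_u Y 0 p" "has_pd_v Y (\<eta> p *\<^sub>R X p + \<omega> p *\<^sub>R l p) p"
    "has_pd_u l (\<kappa> p *\<^sub>R X p) p" "has_pd_v l (- \<omega> p *\<^sub>R Y p) p"
  using assms by (auto simp: adapted_frame_def)

lemma has_pd_u_lor_const: "has_pd_u F F' p \<Longrightarrow> has_pd_u (\<lambda>q. lor (F q) w) (lor F' w) p"
  using has_pd_u_bilinear[OF bounded_bilinear_lor _ has_pd_u_const[of w p]]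
  by (fastforce simp: lor.zero_right)

lemma has_pd_v_lor_const: "has_pd_v F F' p \<Longrightarrow> has_pd_v (\<lambda>q. lor (F q) w) (lor F' w) p"
  using has_pd_v_bilinear[OF bounded_bilinear_lor _ has_pd_v_const[of w p]]
  by (fastforce simp: lor.zero_right)

text \<open>For a Lorentz frame \<open>X\<close>, \<open>Y\<close>, \<open>l\<close> this is the
  linear map carrying it to \<open>X'\<close>, \<open>Y'\<close>, \<open>l'\<close>: the vector
  \<open>w\<close> is expanded in the first frame, and \<open>lor X X = -1\<close> accounts for the
  last sign.\<close>

definition frame_map :: "real^3 \<Rightarrow> real^3 \<Rightarrow> real^3 \<Rightarrow> real^3 \<Rightarrow> real^3 \<Rightarrow> real^3 \<Rightarrow> real^3 \<Rightarrow> real^3" where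
  "frame_map X Y l X' Y' l' w = lor l w *\<^sub>R l' + lor Y w *\<^sub>R Y' - lor X w *\<^sub>R X'"

lemma linear_frame_map: "linear (frame_map X Y l X' Y' l')"
  by (rule linearI) (simp_all add: frame_map_def lor.add_right lor.scaleR_right algebra_simps)

lemma frame_map_apply:
  assumes "lorentz_frame X Y l"
  shows "frame_map X Y l X' Y' l' X = X'" "frame_map X Y l X' Y' l' Y = Y'"
    "frame_map X Y l X' Y' l' l = l'"
  by (simp_all add: frame_map_def lorentz_frame_gram[OF assms])

lemma frame_map_lor:
  assumes "lorentz_frame X Y l" "lorentz_frame X' Y' l'"
  shows "lor (frame_map X Y l X' Y' l' x) (frame_map X Y l X' Y' l' y) = lor x y"
proof -
  have "lor (frame_map X Y l X' Y' l' x) (frame_map X Y l X' Y' l' y)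
      = lor l x * lor l y + lor Y x * lor Y y - lor X x * lor X y"
    by (simp add: frame_map_def lor.add_left lor.add_right lor.diff_left lor.diff_right
        lor.scaleR_left lor.scaleR_right lorentz_frame_gram[OF assms(2)])
  also have "\<dots> = lor (- lor X x *\<^sub>R X + lor Y x *\<^sub>R Y + lor l x *\<^sub>R l) y"
    by (simp add: lor.add_left lor.diff_left lor.scaleR_left lor.minus_left)
  finally show ?thesis using lorentz_frame_expand[OF assms(1), of x] by simp
qed

lemma frame_map_det:
  assumes "lorentz_frame X Y l" "lorentz_frame X' Y' l'"
  shows "det (matrix (frame_map X Y l X' Y' l')) = 1"
proof -
  let ?M = "matrix (frame_map X Y l X' Y' l')"
  have M: "?M *v w = frame_map X Y l X' Y' l' w" for w
    using linear_frame_map by simp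
  have rows: "X' = ?M *v X" "Y' = ?M *v Y" "l' = ?M *v l"
    unfolding M frame_map_apply[OF assms(1)] by simp_all
  \<comment> \<open>The frame vectors are the rows of the matrix, so applying \<open>?M\<close> to
    each of them is multiplication by the transpose from the right.\<close>
  have "(vector [?M *v X, ?M *v Y, ?M *v l] :: real^3^3) = vector [X, Y, l] ** transpose ?M"
    by (simp add: vec_eq_iff forall_3 matrix_matrix_mult_def matrix_vector_mult_def transpose_def
        sum_3 mult.commute)
  then have "det (vector [X', Y', l'] :: real^3^3) = det (vector [X, Y, l] :: real^3^3) * det ?M"
    using rows det_mul[of "vector [X, Y, l]" "transpose ?M"] det_transpose[of ?M] by metis
  then show ?thesis using lorentz_frame_det[OF assms(1)] lorentz_frame_det[OF assms(2)] by simp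
qed

text \<open>The linear map carrying the first frame to the second one has vanishing partial derivatives,
  the connection coefficients being the same.\<close>

lemma adapted_frame_congruence:
  assumes "convex A" "convex B" "A \<noteq> {}" "B \<noteq> {}"
    and f: "adapted_frame (A \<times> B) \<alpha> \<beta> \<eta> \<kappa> \<omega> z X Y l"
    and f': "adapted_frame (A \<times> B) \<alpha> \<beta> \<eta> \<kappa> \<omega> z' X' Y' l'"
  shows "\<exists>T. motion T \<and> (\<forall>p\<in>A \<times> B. z' p = T (z p))"
proof -
  obtain p0 where p0: "p0 \<in> A \<times> B" using assms(3,4) by auto
  define \<Phi> where "\<Phi> p = frame_map (X p) (Y p) (l p) (X' p) (Y' p) (l' p)" for p
  note d = adapted_frameD[OF f] and d' = adapted_frameD[OF f']
  have "has_pd_u (\<lambda>q. \<Phi> q w) 0 p" if p: "p \<in> A \<times> B" for p w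
  proof -
    have "has_pd_u (\<lambda>q. \<Phi> q w)
      ((lor (l p) w *\<^sub>R \<kappa> p *\<^sub>R X' p + lor (\<kappa> p *\<^sub>R X p) w *\<^sub>R l' p) +
       (lor (Y p) w *\<^sub>R 0 + lor 0 w *\<^sub>R Y' p) -
       (lor (X p) w *\<^sub>R \<kappa> p *\<^sub>R l' p + lor (\<kappa> p *\<^sub>R l p) w *\<^sub>R X' p)) p"
      unfolding \<Phi>_def frame_map_def
      by (intro has_pd_u_add has_pd_u_diff has_pd_u_scaleR has_pd_u_lor_const d[OF p] d'[OF p])
    then show ?thesis by (simp add: lor.scaleR_left lor.zero_left algebra_simps)
  qed
  moreover have "has_pd_v (\<lambda>q. \<Phi> q w) 0 p" if p: "p \<in> A \<times> B" for p w
  proof -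
    have "has_pd_v (\<lambda>q. \<Phi> q w)
      ((lor (l p) w *\<^sub>R - \<omega> p *\<^sub>R Y' p + lor (- \<omega> p *\<^sub>R Y p) w *\<^sub>R l' p) +
       (lor (Y p) w *\<^sub>R (\<eta> p *\<^sub>R X' p + \<omega> p *\<^sub>R l' p)
          + lor (\<eta> p *\<^sub>R X p + \<omega> p *\<^sub>R l p) w *\<^sub>R Y' p) -
       (lor (X p) w *\<^sub>R \<eta> p *\<^sub>R Y' p + lor (\<eta> p *\<^sub>R Y p) w *\<^sub>R X' p)) p"
      unfolding \<Phi>_def frame_map_def
      by (intro has_pd_v_add has_pd_v_diff has_pd_v_scaleR has_pd_v_lor_const d[OF p] d'[OF p])
    then show ?thesis
      by (simp add: lor.scaleR_left lor.add_left lor.minus_left algebra_simps)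
  qed
  ultimately have const: "\<Phi> p w = \<Phi> p0 w" if "p \<in> A \<times> B" for p w
    using zero_pd_constant[OF assms(1,2), of "\<lambda>q. \<Phi> q w"] that p0 by blast
  define M where "M = matrix (\<Phi> p0)"
  have M: "M *v w = \<Phi> p w" if "p \<in> A \<times> B" for p w
    using const[OF that] linear_frame_map by (simp add: M_def \<Phi>_def)
  have MX: "M *v X p = X' p" "M *v Y p = Y' p" if p: "p \<in> A \<times> B" for p
    unfolding M[OF p] by (simp_all add: \<Phi>_def frame_map_apply[OF d(1)[OF p]])
  have lin: "bounded_linear ((*v) M)" by (rule matrix_vector_mul_bounded_linear)
  \<comment> \<open>What remains after the linear part is the translation. The partial derivatives
    of this difference vanish because \<open>M\<close> carries \<open>X\<close>, \<open>Y\<close> to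
    \<open>X'\<close>, \<open>Y'\<close> and both surfaces share \<open>\<alpha>\<close> and
    \<open>\<beta>\<close>.\<close>
  define g where "g q = z' q - M *v z q" for q
  have "has_pd_u g 0 p" if p: "p \<in> A \<times> B" for p
  proof -
    have "has_pd_u (\<lambda>q. M *v z q) (M *v (\<alpha> p *\<^sub>R X p)) p"
      using d(2)[OF p] bounded_linear.has_vector_derivative[OF lin] unfolding has_pd_u_def by blast
    from has_pd_u_diff[OF d'(2)[OF p] this] show ?thesis
      unfolding g_def by (simp add: matrix_vector_mult_scaleR MX[OF p])
  qed
  moreover have "has_pd_v g 0 p" if p: "p \<in> A \<times> B" for p
  proof -
    have "has_pd_v (\<lambda>q. M *v z q) (M *v (\<beta> p *\<^sub>R Y p)) p"
      using d(3)[OF p] bounded_linear.has_vector_derivative[OF lin] unfolding has_pd_v_def by blast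
    from has_pd_v_diff[OF d'(3)[OF p] this] show ?thesis
      unfolding g_def by (simp add: matrix_vector_mult_scaleR MX[OF p])
  qed
  ultimately have "g p = g p0" if "p \<in> A \<times> B" for p
    using zero_pd_constant[OF assms(1,2), of g] that p0 by blast
  then have "z' p = M *v z p + g p0" if "p \<in> A \<times> B" for p
    using that by (simp add: g_def diff_eq_eq add.commute)
  moreover have "motion (\<lambda>x. M *v x + g p0)"
  proof -
    have "lor (M *v x) (M *v y) = lor x y" for x y
      unfolding M[OF p0] \<Phi>_def by (rule frame_map_lor[OF d(1)[OF p0] d'(1)[OF p0]])
    moreover have "det M = 1"
      unfolding M_def \<Phi>_def by (rule frame_map_det[OF d(1)[OF p0] d'(1)[OF p0]])
    ultimately show ?thesis unfolding motion_def by blast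
  qed
  ultimately show ?thesis by blast
qed

text \<open>A change of \<open>v\<close> leaves derivatives in \<open>u\<close> alone and multiplies
  those in \<open>v\<close> by \<open>\<phi>'\<close>. Exactly \<open>\<beta>\<close>,
  \<open>\<eta>\<close> and \<open>\<omega>\<close> acquire this factor.\<close>

lemma adapted_frame_reparam:
  assumes f: "adapted_frame R \<alpha> \<beta> \<eta> \<kappa> \<omega> z X Y l"
    and \<phi>: "\<And>p. p \<in> R' \<Longrightarrow> (\<phi> has_vector_derivative \<phi>' (snd p)) (at (snd p))"
    and sub: "\<And>p. p \<in> R' \<Longrightarrow> (fst p, \<phi> (snd p)) \<in> R"
  defines "\<Psi> \<equiv> \<lambda>p. (fst p, \<phi> (snd p))"
  shows "adapted_frame R' (\<lambda>p. \<alpha> (\<Psi> p)) (\<lambda>p. \<phi>' (snd p) * \<beta> (\<Psi> p)) (\<lambda>p. \<phi>' (snd p) * \<eta> (\<Psi> p))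
    (\<lambda>p. \<kappa> (\<Psi> p)) (\<lambda>p. \<phi>' (snd p) * \<omega> (\<Psi> p))
    (\<lambda>p. z (\<Psi> p)) (\<lambda>p. X (\<Psi> p)) (\<lambda>p. Y (\<Psi> p)) (\<lambda>p. l (\<Psi> p))"
proof -
  have u: "has_pd_u (\<lambda>q. F (\<Psi> q)) d p" if "has_pd_u F d (\<Psi> p)" for F :: "real \<times> real \<Rightarrow> real^3" and d p
    using that by (simp add: has_pd_u_def \<Psi>_def)
  have v: "has_pd_v (\<lambda>q. F (\<Psi> q)) (\<phi>' (snd p) *\<^sub>R d) p" if "has_pd_v F d (\<Psi> p)" "p \<in> R'"
    for F :: "real \<times> real \<Rightarrow> real^3" and d p
    using that(1) vector_diff_chain_at[OF \<phi>[OF that(2)]] by (simp add: has_pd_v_def \<Psi>_def o_def)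
  show ?thesis unfolding adapted_frame_def
  proof (intro ballI conjI)
    fix p assume p: "p \<in> R'"
    then have q: "\<Psi> p \<in> R" using sub by (simp add: \<Psi>_def)
    note d = adapted_frameD[OF f q]
    show "lorentz_frame (X (\<Psi> p)) (Y (\<Psi> p)) (l (\<Psi> p))" by (rule d(1))
    show "has_pd_u (\<lambda>p. z (\<Psi> p)) (\<alpha> (\<Psi> p) *\<^sub>R X (\<Psi> p)) p" by (rule u[OF d(2)])
    show "has_pd_u (\<lambda>p. X (\<Psi> p)) (\<kappa> (\<Psi> p) *\<^sub>R l (\<Psi> p)) p" by (rule u[OF d(4)])
    show "has_pd_u (\<lambda>p. Y (\<Psi> p)) 0 p" by (rule u[OF d(6)])
    show "has_pd_u (\<lambda>p. l (\<Psi> p)) (\<kappa> (\<Psi> p) *\<^sub>R X (\<Psi> p)) p" by (rule u[OF d(8)])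
    show "has_pd_v (\<lambda>p. z (\<Psi> p)) ((\<phi>' (snd p) * \<beta> (\<Psi> p)) *\<^sub>R Y (\<Psi> p)) p"
      using v[OF d(3) p] by simp
    show "has_pd_v (\<lambda>p. X (\<Psi> p)) ((\<phi>' (snd p) * \<eta> (\<Psi> p)) *\<^sub>R Y (\<Psi> p)) p"
      using v[OF d(5) p] by simp
    show "has_pd_v (\<lambda>p. Y (\<Psi> p)) ((\<phi>' (snd p) * \<eta> (\<Psi> p)) *\<^sub>R X (\<Psi> p) +
        (\<phi>' (snd p) * \<omega> (\<Psi> p)) *\<^sub>R l (\<Psi> p)) p"
      using v[OF d(7) p] by (simp add: scaleR_add_right)
    show "has_pd_v (\<lambda>p. l (\<Psi> p)) (- (\<phi>' (snd p) * \<omega> (\<Psi> p)) *\<^sub>R Y (\<Psi> p)) p"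
      using v[OF d(9) p] by simp
  qed
qed

text \<open>That \<open>sqrt (- E)\<close> is a function of \<open>u\<close> makes
  \<open>E_v\<close> vanish, and with it \<open>gamma1\<close>. The curvatures come from
  differentiating \<open>e X\<close> and \<open>\<beta> Y\<close> by the frame equations and pairing
  with \<open>l\<close>.\<close>

lemma adapted_frame_invariants:
  assumes f: "adapted_frame R (\<lambda>p. e (fst p)) \<beta> \<eta> \<kappa> \<omega> z X Y l"
    and R: "open R" "p \<in> R"
    and e: "\<And>p. p \<in> R \<Longrightarrow> e (fst p) > 0"
      "\<And>p. p \<in> R \<Longrightarrow> (e has_vector_derivative e' (fst p)) (at (fst p))"
    and \<beta>: "\<And>p. p \<in> R \<Longrightarrow> \<beta> p > 0" "\<And>p. p \<in> R \<Longrightarrow> has_pd_u \<beta> (\<beta>u p) p"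
      "\<And>p. p \<in> R \<Longrightarrow> has_pd_v \<beta> (\<beta>v p) p"
  shows "E_coef z p = - (e (fst p))\<^sup>2" "G_coef z p = (\<beta> p)\<^sup>2" "F_coef z p = 0" "M_coef z p = 0"
    "nu1 z p = - \<kappa> p / e (fst p)" "nu2 z p = \<omega> p / \<beta> p" "gamma1 z p = 0"
    "gamma2 z p = - \<beta>u p / (\<beta> p * e (fst p))"
proof -
  note d = adapted_frameD[OF f]
  have zu: "pd_u z p = e (fst p) *\<^sub>R X p" and zv: "pd_v z p = \<beta> p *\<^sub>R Y p" if "p \<in> R" for p
    using pd_u_eqI pd_v_eqI d[OF that] by blast+
  have E: "E_coef z p = - (e (fst p))\<^sup>2" and G: "G_coef z p = (\<beta> p)\<^sup>2" and F: "F_coef z p = 0" if "p \<in> R" for p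
    using lorentz_frame_gram[OF d(1)[OF that]]
    by (simp_all add: E_coef_def G_coef_def F_coef_def zu[OF that] zv[OF that] lor.scaleR_left
        lor.scaleR_right power2_eq_square)
  show "E_coef z p = - (e (fst p))\<^sup>2" "G_coef z p = (\<beta> p)\<^sup>2" "F_coef z p = 0"
    using E G F R(2) by auto
  have sq: "sqrt (- E_coef z p) = e (fst p)" "sqrt (G_coef z p) = \<beta> p"
    using E G R(2) e(1) \<beta>(1) by (auto simp: less_imp_le)
  have l: "unit_normal z p = l p"
  proof (rule unit_normal_eq)
    show "E_coef z p < 0" "G_coef z p > 0"
      using E[OF R(2)] G[OF R(2)] e(1)[OF R(2)] \<beta>(1)[OF R(2)] by auto
    have "X_frame z p = X p" "Y_frame z p = Y p"
      using e(1)[OF R(2)] \<beta>(1)[OF R(2)] unfolding X_frame_def Y_frame_def sq zu[OF R(2)] zv[OF R(2)] by auto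
    then show "lorentz_frame (X_frame z p) (Y_frame z p) (l p)"
      using d(1)[OF R(2)] by simp
  qed
  have zuu: "pd_u (pd_u z) p = e (fst p) *\<^sub>R \<kappa> p *\<^sub>R l p + e' (fst p) *\<^sub>R X p"
    by (rule pd_u_eqI, rule has_pd_u_cong[OF R zu[symmetric]], assumption,
        intro has_pd_u_scaleR d(4) R has_pd_u_fst e)
  have zuv: "pd_v (pd_u z) p = e (fst p) *\<^sub>R \<eta> p *\<^sub>R Y p + 0 *\<^sub>R X p"
    by (rule pd_v_eqI, rule has_pd_v_cong[OF R zu[symmetric]], assumption,
        intro has_pd_v_scaleR d(5) R has_pd_v_fst)
  have zvv: "pd_v (pd_v z) p = \<beta> p *\<^sub>R (\<eta> p *\<^sub>R X p + \<omega> p *\<^sub>R l p) + \<beta>v p *\<^sub>R Y p"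
    by (rule pd_v_eqI, rule has_pd_v_cong[OF R zv[symmetric]], assumption,
        intro has_pd_v_scaleR d(7) R \<beta>)
  note g = lorentz_frame_gram[OF d(1)[OF R(2)]]
  have pos: "e (fst p) > 0" "\<beta> p > 0" using e \<beta> R by auto
  have "L_coef z p = e (fst p) * \<kappa> p" "N_coef z p = \<beta> p * \<omega> p"
    by (simp_all add: L_coef_def N_coef_def l zuu zvv lor.add_right lor.scaleR_right g)
  then show "nu1 z p = - \<kappa> p / e (fst p)" "nu2 z p = \<omega> p / \<beta> p"
    using pos by (auto simp: nu1_def nu2_def E[OF R(2)] G[OF R(2)] power2_eq_square)
  show "M_coef z p = 0" by (simp add: M_coef_def l zuv lor.scaleR_right g)
  have "pd_v (E_coef z) p = 0"
    by (rule pd_v_eqI, rule has_pd_v_cong[OF R E[symmetric]])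
      (auto intro: has_pd_v_fst[of "\<lambda>u. - (e u)\<^sup>2"])
  then show "gamma1 z p = 0" by (simp add: gamma1_def)
  have "pd_u (G_coef z) p = \<beta> p * \<beta>u p + \<beta>u p * \<beta> p"
    by (rule pd_u_eqI, rule has_pd_u_cong[OF R G[symmetric]], assumption,
        unfold power2_eq_square, intro has_pd_u_bilinear[OF bounded_bilinear_mult] \<beta> R)
  then show "gamma2 z p = - \<beta>u p / (\<beta> p * e (fst p))"
    using pos unfolding gamma2_def sq G[OF R(2)] by (simp add: field_simps power2_eq_square)
qed

section \<open>The adapted frame of a surface\<close>

lemma has_pd_u_compose:
  assumes "(\<phi> has_real_derivative d) (at (F p))" "has_pd_u F F' p"
  shows "has_pd_u (\<lambda>q. \<phi> (F q)) (d * F') p"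
  using field_vector_diff_chain_at[of "\<lambda>s. F (s, snd p)" F' "fst p" \<phi> d] assms
  by (simp add: has_pd_u_def o_def mult.commute)

lemma has_pd_v_compose:
  assumes "(\<phi> has_real_derivative d) (at (F p))" "has_pd_v F F' p"
  shows "has_pd_v (\<lambda>q. \<phi> (F q)) (d * F') p"
  using field_vector_diff_chain_at[of "\<lambda>s. F (fst p, s)" F' "snd p" \<phi> d] assms
  by (simp add: has_pd_v_def o_def mult.commute)

lemma inverse_sqrt_deriv: "(x::real) > 0 \<Longrightarrow> \<exists>d. ((\<lambda>x. inverse (sqrt x)) has_real_derivative d) (at x)"
  by (rule exI, rule DERIV_inverse', rule DERIV_real_sqrt) auto

lemma has_pd_u_lor_skew:
  assumes "open R" "p \<in> R" "\<And>q. q \<in> R \<Longrightarrow> lor (F q) (G q) = c" "has_pd_u F F' p" "has_pd_u G G' p"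
  shows "lor (F p) G' + lor F' (G p) = 0"
  using has_pd_u_cong[OF assms(1,2) assms(3) has_pd_u_bilinear[OF bounded_bilinear_lor assms(4,5)]]
    has_pd_u_const has_pd_u_unique by metis

lemma has_pd_v_lor_skew:
  assumes "open R" "p \<in> R" "\<And>q. q \<in> R \<Longrightarrow> lor (F q) (G q) = c" "has_pd_v F F' p" "has_pd_v G G' p"
  shows "lor (F p) G' + lor F' (G p) = 0"
  using has_pd_v_cong[OF assms(1,2) assms(3) has_pd_v_bilinear[OF bounded_bilinear_lor assms(4,5)]]
    has_pd_v_const has_pd_v_unique by metis

locale timelike =
  fixes k :: enat and D :: "(real \<times> real) set" and z :: "real \<times> real \<Rightarrow> real^3"
  assumes surf: "timelike_surface k D z" and k: "3 \<le> k"
begin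

lemma D: "open D" and z_ck: "ck_nat 2 D z"
  and EG: "\<And>p. p \<in> D \<Longrightarrow> E_coef z p < 0" "\<And>p. p \<in> D \<Longrightarrow> G_coef z p > 0"
    "\<And>p. p \<in> D \<Longrightarrow> F_coef z p = 0" "\<And>p. p \<in> D \<Longrightarrow> M_coef z p = 0"
proof -
  have "enat 2 \<le> enat 3" by simp
  also have "enat 3 \<le> k" using k by (simp add: numeral_eq_enat)
  finally have "enat 2 \<le> k" .
  then show "open D" "ck_nat 2 D z"
    "\<And>p. p \<in> D \<Longrightarrow> E_coef z p < 0" "\<And>p. p \<in> D \<Longrightarrow> G_coef z p > 0"
    "\<And>p. p \<in> D \<Longrightarrow> F_coef z p = 0" "\<And>p. p \<in> D \<Longrightarrow> M_coef z p = 0"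
    using surf by (auto simp: timelike_surface_def ck_def)
qed

abbreviation "X \<equiv> X_frame z"
abbreviation "Y \<equiv> Y_frame z"
abbreviation "l \<equiv> unit_normal z"

text \<open>Symmetry of the second derivatives is built in: the \<open>u\<close> derivative of
  \<open>pd_v z\<close> is recorded as \<open>pd_v (pd_u z)\<close>, the expression that occurs in
  \<open>M_coef\<close>.\<close>

lemma pd_z: "p \<in> D \<Longrightarrow> has_pd_u z (pd_u z p) p" "p \<in> D \<Longrightarrow> has_pd_v z (pd_v z p) p"
  and pd_zu: "p \<in> D \<Longrightarrow> has_pd_u (pd_u z) (pd_u (pd_u z) p) p"
    "p \<in> D \<Longrightarrow> has_pd_v (pd_u z) (pd_v (pd_u z) p) p"
  and pd_zv: "p \<in> D \<Longrightarrow> has_pd_u (pd_v z) (pd_v (pd_u z) p) p"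
    "p \<in> D \<Longrightarrow> has_pd_v (pd_v z) (pd_v (pd_v z) p) p"
  and cont: "continuous_on D (pd_u z)" "continuous_on D (pd_v z)" "continuous_on D (pd_v (pd_u z))"
proof -
  have 2: "ck_nat (Suc (Suc 0)) D z" using z_ck by (simp add: numeral_2_eq_2 del: ck_nat.simps)
  note 1 = ck_nat_pd[OF D 2]
  note u = ck_nat_pd[OF D 1(1)] and v = ck_nat_pd[OF D 1(2)]
  show "p \<in> D \<Longrightarrow> has_pd_u z (pd_u z p) p" "p \<in> D \<Longrightarrow> has_pd_v z (pd_v z p) p"
    "p \<in> D \<Longrightarrow> has_pd_u (pd_u z) (pd_u (pd_u z) p) p"
    "p \<in> D \<Longrightarrow> has_pd_v (pd_u z) (pd_v (pd_u z) p) p"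
    "p \<in> D \<Longrightarrow> has_pd_v (pd_v z) (pd_v (pd_v z) p) p"
    using 1 u v by blast+
  show "continuous_on D (pd_u z)" "continuous_on D (pd_v z)" "continuous_on D (pd_v (pd_u z))"
    using 1 u v ck_nat_continuous_on by blast+
  show "has_pd_u (pd_v z) (pd_v (pd_u z) p) p" if "p \<in> D"
    using mixed_pd_eq[OF D that 1(3) 1(4) u(4) v(3) ck_nat_continuous_on[OF u(2)] ck_nat_continuous_on[OF v(1)]]
      v(3)[OF that] by metis
qed

lemma z_frame:
  assumes "p \<in> D"
  shows "pd_u z p = sqrt (- E_coef z p) *\<^sub>R X p" "pd_v z p = sqrt (G_coef z p) *\<^sub>R Y p"
  using EG(1,2)[OF assms] by (auto simp: X_frame_def Y_frame_def)

lemma frame: "p \<in> D \<Longrightarrow> lorentz_frame (X p) (Y p) (l p)" and normal: "p \<in> D \<Longrightarrow> l p = lcross (X p) (Y p)"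
proof -
  assume p: "p \<in> D"
  note E = EG[OF p]
  have "lor (X p) (X p) = -1"
    using E by (simp add: X_frame_def E_coef_def lor.scaleR_left lor.scaleR_right field_simps)
  moreover have "lor (Y p) (Y p) = 1"
    using E by (simp add: Y_frame_def G_coef_def lor.scaleR_left lor.scaleR_right field_simps)
  moreover have "lor (X p) (Y p) = 0"
    using E by (simp add: X_frame_def Y_frame_def F_coef_def lor.scaleR_left lor.scaleR_right)
  ultimately have "lorentz_frame (X p) (Y p) (lcross (X p) (Y p))"
    by (rule lorentz_frame_lcross)
  moreover from this show "l p = lcross (X p) (Y p)"
    using unit_normal_eq E by blast
  ultimately show "lorentz_frame (X p) (Y p) (l p)" by simp
qed

lemma E_pd:
  assumes "p \<in> D"
  shows "has_pd_u (E_coef z) (2 * lor (pd_u z p) (pd_u (pd_u z) p)) p"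
    "has_pd_v (E_coef z) (2 * lor (pd_u z p) (pd_v (pd_u z) p)) p"
  using has_pd_u_bilinear[OF bounded_bilinear_lor pd_zu(1)[OF assms] pd_zu(1)[OF assms]]
    has_pd_v_bilinear[OF bounded_bilinear_lor pd_zu(2)[OF assms] pd_zu(2)[OF assms]]
    lor_commute[of "pd_u z p"]
  unfolding E_coef_def by simp_all

lemma G_pd:
  assumes "p \<in> D"
  shows "has_pd_u (G_coef z) (2 * lor (pd_v z p) (pd_v (pd_u z) p)) p"
    "has_pd_v (G_coef z) (2 * lor (pd_v z p) (pd_v (pd_v z) p)) p"
  using has_pd_u_bilinear[OF bounded_bilinear_lor pd_zv(1)[OF assms] pd_zv(1)[OF assms]]
    has_pd_v_bilinear[OF bounded_bilinear_lor pd_zv(2)[OF assms] pd_zv(2)[OF assms]]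
    lor_commute[of "pd_v z p"]
  unfolding G_coef_def by simp_all

text \<open>Existence is all that is recorded. The values are determined later from the constant
  products of the frame and from \<open>z_uv\<close>.\<close>

lemma X_pd_ex:
  assumes "p \<in> D"
  shows "\<exists>d. has_pd_u X d p" "\<exists>d. has_pd_v X d p"
proof -
  obtain d where d: "((\<lambda>x. inverse (sqrt x)) has_real_derivative d) (at (- E_coef z p))"
    using inverse_sqrt_deriv[of "- E_coef z p"] EG[OF assms] by auto
  have "has_pd_u (\<lambda>q. - E_coef z q) (0 - 2 * lor (pd_u z p) (pd_u (pd_u z) p)) p"
    using has_pd_u_diff[OF has_pd_u_const[of 0] E_pd(1)[OF assms]] by simp
  from has_pd_u_scaleR[OF has_pd_u_compose[where F="\<lambda>q. - E_coef z q", OF d this] pd_zu(1)[OF assms]]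
  show "\<exists>d. has_pd_u X d p" unfolding X_frame_def[abs_def] by blast
  have "has_pd_v (\<lambda>q. - E_coef z q) (0 - 2 * lor (pd_u z p) (pd_v (pd_u z) p)) p"
    using has_pd_v_diff[OF has_pd_v_const[of 0] E_pd(2)[OF assms]] by simp
  from has_pd_v_scaleR[OF has_pd_v_compose[where F="\<lambda>q. - E_coef z q", OF d this] pd_zu(2)[OF assms]]
  show "\<exists>d. has_pd_v X d p" unfolding X_frame_def[abs_def] by blast
qed

lemma Y_pd_ex:
  assumes "p \<in> D"
  shows "\<exists>d. has_pd_u Y d p" "\<exists>d. has_pd_v Y d p"
proof -
  obtain d where d: "((\<lambda>x. inverse (sqrt x)) has_real_derivative d) (at (G_coef z p))"
    using inverse_sqrt_deriv[of "G_coef z p"] EG[OF assms] by auto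
  from has_pd_u_scaleR[OF has_pd_u_compose[OF d G_pd(1)[OF assms]] pd_zv(1)[OF assms]]
  show "\<exists>d. has_pd_u Y d p" unfolding Y_frame_def[abs_def] by blast
  from has_pd_v_scaleR[OF has_pd_v_compose[OF d G_pd(2)[OF assms]] pd_zv(2)[OF assms]]
  show "\<exists>d. has_pd_v Y d p" unfolding Y_frame_def[abs_def] by blast
qed

text \<open>The definite description behind \<open>unit_normal\<close> offers nothing to
  differentiate, but its value \<open>lcross X Y\<close> on the open set \<open>D\<close>
  does.\<close>

lemma l_pd_ex:
  assumes "p \<in> D"
  shows "\<exists>d. has_pd_u l d p" "\<exists>d. has_pd_v l d p"
proof -
  obtain d1 d2 where "has_pd_u X d1 p" "has_pd_u Y d2 p"
    using X_pd_ex Y_pd_ex assms by blast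
  from has_pd_u_cong[OF D assms normal[symmetric] has_pd_u_bilinear[OF bounded_bilinear_lcross this]]
  show "\<exists>d. has_pd_u l d p" by blast
  obtain d3 d4 where "has_pd_v X d3 p" "has_pd_v Y d4 p"
    using X_pd_ex Y_pd_ex assms by blast
  from has_pd_v_cong[OF D assms normal[symmetric] has_pd_v_bilinear[OF bounded_bilinear_lcross this]]
  show "\<exists>d. has_pd_v l d p" by blast
qed

text \<open>Differentiating \<open>lor l l = 1\<close> shows that the derivatives of
  \<open>l\<close> are tangent. Differentiating the orthogonality to \<open>z_u\<close> and
  \<open>z_v\<close> gives their components as minus the second fundamental form, and
  \<open>M = 0\<close> leaves a single one in each.\<close>

lemma weingarten:
  assumes p: "p \<in> D"
  shows "has_pd_u l (- nu1 z p *\<^sub>R pd_u z p) p" "has_pd_v l (- nu2 z p *\<^sub>R pd_v z p) p"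
proof -
  note g = lorentz_frame_gram[OF frame]
  have tang: "lor (l q) (l q) = 1" "lor (l q) (pd_u z q) = 0" "lor (l q) (pd_v z q) = 0" if "q \<in> D" for q
    using g[OF that] by (simp_all add: z_frame[OF that] lor.scaleR_right)
  have exp: "d = (- (lor d (pd_u z p)) / (- E_coef z p)) *\<^sub>R pd_u z p + (lor d (pd_v z p) / G_coef z p) *\<^sub>R pd_v z p"
    if "lor (l p) d = 0" for d
  proof -
    obtain s t where "s > 0" "t > 0" "E_coef z p = - (s * s)" "G_coef z p = t * t"
      and z: "pd_u z p = s *\<^sub>R X p" "pd_v z p = t *\<^sub>R Y p"
      using z_frame[OF p] EG[OF p] real_sqrt_mult_self[of "- E_coef z p"] real_sqrt_mult_self[of "G_coef z p"]
      by (smt (verit) real_sqrt_gt_zero)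
    then show ?thesis
      using lorentz_frame_expand[OF frame[OF p], of d] that lor_commute[of d]
      by (simp add: lor.scaleR_right)
  qed
  obtain d where d: "has_pd_u l d p" using l_pd_ex p by blast
  have "lor (l p) d + lor d (l p) = 0"
    by (rule has_pd_u_lor_skew[OF D p tang(1) d d])
  moreover have "lor d (pd_u z p) = - lor (l p) (pd_u (pd_u z) p)"
    using has_pd_u_lor_skew[OF D p tang(2) d pd_zu(1)[OF p]] by linarith
  moreover have "lor d (pd_v z p) = - lor (l p) (pd_v (pd_u z) p)"
    using has_pd_u_lor_skew[OF D p tang(3) d pd_zv(1)[OF p]] by linarith
  ultimately have "d = - nu1 z p *\<^sub>R pd_u z p"
    using exp[of d] EG[OF p] lor_commute[of d "l p"] by (simp add: nu1_def L_coef_def M_coef_def)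
  with d show "has_pd_u l (- nu1 z p *\<^sub>R pd_u z p) p" by simp
  obtain d where d: "has_pd_v l d p" using l_pd_ex p by blast
  have "lor (l p) d + lor d (l p) = 0"
    by (rule has_pd_v_lor_skew[OF D p tang(1) d d])
  moreover have "lor d (pd_u z p) = - lor (l p) (pd_v (pd_u z) p)"
    using has_pd_v_lor_skew[OF D p tang(2) d pd_zu(2)[OF p]] by linarith
  moreover have "lor d (pd_v z p) = - lor (l p) (pd_v (pd_v z) p)"
    using has_pd_v_lor_skew[OF D p tang(3) d pd_zv(2)[OF p]] by linarith
  ultimately have "d = - nu2 z p *\<^sub>R pd_v z p"
    using exp[of d] EG[OF p] lor_commute[of d "l p"]
    by (simp add: nu2_def N_coef_def M_coef_def)
  with d show "has_pd_v l (- nu2 z p *\<^sub>R pd_v z p) p" by simp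
qed

end

text \<open>Here \<open>j\<close> stands for \<open>J_u\<close>, and \<open>e\<close> for the value
  that \<open>sqrt (- E)\<close> turns out to have. The condition \<open>codazzi\<close> is the
  definition of \<open>J\<close> in differentiated form, \<open>J_u = g' / (g - f)\<close> with
  \<open>g'\<close> the derivative in \<open>u\<close>.\<close>

locale rotational_timelike = timelike +
  fixes f g g' j e :: "real \<Rightarrow> real"
  assumes nu: "\<And>p. p \<in> D \<Longrightarrow> nu1 z p = f (fst p)" "\<And>p. p \<in> D \<Longrightarrow> nu2 z p = g (fst p)"
    and gamma: "\<And>p. p \<in> D \<Longrightarrow> gamma2 z p = j (fst p) / e (fst p)"
    and g': "\<And>p. p \<in> D \<Longrightarrow> (g has_vector_derivative g' (fst p)) (at (fst p))"
    and codazzi: "\<And>p. p \<in> D \<Longrightarrow> g' (fst p) = j (fst p) * (g (fst p) - f (fst p))"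
    and cont_fg: "continuous_on (fst ` D) f" "continuous_on (fst ` D) g" "continuous_on (fst ` D) g'"
    and j: "\<And>p. p \<in> D \<Longrightarrow> j (fst p) \<noteq> 0"
    and fg: "\<And>p. p \<in> D \<Longrightarrow> f (fst p) \<noteq> g (fst p)"
    and e: "\<And>p. p \<in> D \<Longrightarrow> e (fst p) > 0"
begin

text \<open>Equality of \<open>l_uv\<close> and \<open>l_vu\<close> reads
  \<open>- f z_uv = - g z_uv - g' z_v\<close>; now insert \<open>g' = j (g - f)\<close> and cancel
  \<open>f - g\<close>. The function \<open>f\<close> is differentiated only in \<open>v\<close>, on
  which it does not depend.\<close>

lemma z_uv: assumes p: "p \<in> D" shows "pd_v (pd_u z) p = - j (fst p) *\<^sub>R pd_v z p"
proof -
  have cf: "continuous_on D (\<lambda>q. h (fst q))" if "continuous_on (fst ` D) h" for h :: "real \<Rightarrow> real"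
    using that by (intro continuous_on_compose2[of "fst ` D" h D fst] continuous_intros) auto
  let ?A = "\<lambda>q. - (f (fst q) *\<^sub>R pd_v (pd_u z) q + 0 *\<^sub>R pd_u z q)"
  let ?B = "\<lambda>q. - (g (fst q) *\<^sub>R pd_v (pd_u z) q + g' (fst q) *\<^sub>R pd_v z q)"
  have "?A p = ?B p"
  proof (rule mixed_pd_eq[OF D p, of l])
    show "has_pd_u l (0 - f (fst q) *\<^sub>R pd_u z q) q" "has_pd_v l (0 - g (fst q) *\<^sub>R pd_v z q) q" if "q \<in> D" for q
      using weingarten[OF that] nu[OF that] by simp_all
    show "has_pd_v (\<lambda>q. 0 - f (fst q) *\<^sub>R pd_u z q) (?A q) q" if "q \<in> D" for q
      unfolding diff_0[symmetric]
      by (intro has_pd_v_diff has_pd_v_const has_pd_v_scaleR has_pd_v_fst pd_zu that)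
    show "has_pd_u (\<lambda>q. 0 - g (fst q) *\<^sub>R pd_v z q) (?B q) q" if "q \<in> D" for q
      unfolding diff_0[symmetric]
      by (intro has_pd_u_diff has_pd_u_const has_pd_u_scaleR has_pd_u_fst pd_zv g' that)
    show "continuous_on D ?A" "continuous_on D ?B"
      using cont cont_fg by (auto intro!: continuous_intros cf)
  qed
  then have "(f (fst p) - g (fst p)) *\<^sub>R pd_v (pd_u z) p = (f (fst p) - g (fst p)) *\<^sub>R (- j (fst p) *\<^sub>R pd_v z p)"
    using codazzi[OF p] by (simp add: algebra_simps)
  then show ?thesis using fg[OF p] by (metis right_minus_eq scaleR_cancel_left)
qed

text \<open>A linear equation along the \<open>u\<close> lines; it determines \<open>G\<close> up to
  a factor depending on \<open>v\<close>.\<close>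

lemma G_pd_u: "p \<in> D \<Longrightarrow> has_pd_u (G_coef z) (- 2 * j (fst p) * G_coef z p) p"
  using G_pd(1)[of p] by (simp add: z_uv lor.minus_right lor.scaleR_right G_coef_def mult.assoc)

text \<open>Since \<open>G_u / G = - 2 j\<close>, the second geodesic curvature equals
  \<open>j / sqrt (- E)\<close>. It is prescribed as \<open>j / e\<close>, and \<open>j\<close> does
  not vanish.\<close>

lemma sqrt_E: assumes "p \<in> D" shows "sqrt (- E_coef z p) = e (fst p)"
proof -
  have "j (fst p) / sqrt (- E_coef z p) = j (fst p) / e (fst p)"
    using gamma[OF assms] EG[OF assms] pd_u_eqI[OF G_pd_u[OF assms]] by (simp add: gamma2_def)
  then show ?thesis using j[OF assms] e[OF assms] EG[OF assms] by (simp add: field_simps)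
qed

lemma adapted:
  "adapted_frame D (\<lambda>p. e (fst p)) (\<lambda>p. sqrt (G_coef z p)) (\<lambda>p. - j (fst p) * sqrt (G_coef z p) / e (fst p))
    (\<lambda>p. - f (fst p) * e (fst p)) (\<lambda>p. g (fst p) * sqrt (G_coef z p)) z X Y l"
  unfolding adapted_frame_def
proof (intro ballI conjI)
  fix p assume p: "p \<in> D"
  note fr = frame[OF p] and g = lorentz_frame_gram[OF frame]
  have zu: "pd_u z q = e (fst q) *\<^sub>R X q" and zv: "pd_v z q = sqrt (G_coef z q) *\<^sub>R Y q" if "q \<in> D" for q
    using z_frame[OF that] sqrt_E[OF that] by simp_all
  show "lorentz_frame (X p) (Y p) (l p)" by (rule fr)
  show "has_pd_u z (e (fst p) *\<^sub>R X p) p" "has_pd_v z (sqrt (G_coef z p) *\<^sub>R Y p) p"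
    using pd_z[OF p] zu[OF p] zv[OF p] by simp_all
  show lu: "has_pd_u l ((- f (fst p) * e (fst p)) *\<^sub>R X p) p"
    and lv: "has_pd_v l (- (g (fst p) * sqrt (G_coef z p)) *\<^sub>R Y p) p"
    using weingarten[OF p] nu[OF p] zu[OF p] zv[OF p] by simp_all
  obtain Xu Xv Yu Yv where d: "has_pd_u X Xu p" "has_pd_v X Xv p" "has_pd_u Y Yu p" "has_pd_v Y Yv p"
    using X_pd_ex Y_pd_ex p by blast
  \<comment> \<open>Each constant product of the frame removes one component or ties two together.
    The vector \<open>X_v\<close> and the component of \<open>Y_u\<close> along \<open>X\<close> are
    found from \<open>z_uv\<close> below.\<close>
  note s = has_pd_u_lor_skew[OF D p g(1) d(1,1)] has_pd_u_lor_skew[OF D p g(2) d(3,3)]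
    has_pd_u_lor_skew[OF D p g(4) d(1,3)] has_pd_u_lor_skew[OF D p g(5) d(1) lu]
    has_pd_u_lor_skew[OF D p g(6) d(3) lu] has_pd_v_lor_skew[OF D p g(2) d(4,4)]
    has_pd_v_lor_skew[OF D p g(4) d(2,4)] has_pd_v_lor_skew[OF D p g(6) d(4) lv]
  note s' = s[unfolded lor.scaleR_right g[OF p]]
  \<comment> \<open>As \<open>e\<close> does not depend on \<open>v\<close>, the mixed derivative is
    \<open>e\<close> times \<open>X_v\<close>, and its known value yields
    \<open>X_v\<close>.\<close>
  have "has_pd_v (\<lambda>q. e (fst q) *\<^sub>R X q) (e (fst p) *\<^sub>R Xv + 0 *\<^sub>R X p) p"
    by (intro has_pd_v_scaleR has_pd_v_fst d)
  from has_pd_v_cong[OF D p _ this, of "pd_u z"] zu have "pd_v (pd_u z) p = e (fst p) *\<^sub>R Xv"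
    by (auto intro!: pd_v_eqI)
  then have "e (fst p) *\<^sub>R Xv = e (fst p) *\<^sub>R ((- j (fst p) * sqrt (G_coef z p) / e (fst p)) *\<^sub>R Y p)"
    using z_uv[OF p] zv[OF p] e[OF p] by simp
  then have Xv: "Xv = (- j (fst p) * sqrt (G_coef z p) / e (fst p)) *\<^sub>R Y p"
    using e[OF p] by (metis less_irrefl scaleR_cancel_left)
  with d(2) show "has_pd_v X ((- j (fst p) * sqrt (G_coef z p) / e (fst p)) *\<^sub>R Y p) p" by simp
  \<comment> \<open>The same mixed derivative, now as the \<open>u\<close> derivative of
    \<open>sqrt G\<close> times \<open>Y\<close>. All terms except the one with \<open>Y_u\<close>
    point along \<open>Y\<close>, so pairing with \<open>X\<close> isolates the missing
    component.\<close>
  have "((\<lambda>x. sqrt x) has_real_derivative inverse (sqrt (G_coef z p)) / 2) (at (G_coef z p))"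
    using DERIV_real_sqrt EG[OF p] by blast
  from has_pd_u_scaleR[OF has_pd_u_compose[OF this G_pd_u[OF p]] d(3)]
  have "has_pd_u (pd_v z) (sqrt (G_coef z p) *\<^sub>R Yu +
    (inverse (sqrt (G_coef z p)) / 2 * (- 2 * j (fst p) * G_coef z p)) *\<^sub>R Y p) p" (is "has_pd_u _ (_ + ?c *\<^sub>R _) _")
    by (rule has_pd_u_cong[OF D p zv[symmetric], rotated])
  from has_pd_u_unique[OF this pd_zv(1)[OF p]]
  have "sqrt (G_coef z p) *\<^sub>R Yu + ?c *\<^sub>R Y p = (- j (fst p) * sqrt (G_coef z p)) *\<^sub>R Y p"
    using z_uv[OF p] zv[OF p] by simp
  then have "lor (X p) (sqrt (G_coef z p) *\<^sub>R Yu + ?c *\<^sub>R Y p) = lor (X p) ((- j (fst p) * sqrt (G_coef z p)) *\<^sub>R Y p)"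
    by simp
  then have XYu: "lor (X p) Yu = 0"
    using EG[OF p]
    by (simp add: lor.add_right lor.diff_right lor.minus_right lor.scaleR_right g[OF p])
  have "Yu = 0"
    using lorentz_frame_expand[OF fr, of Yu] s' XYu lor_commute[of Yu] by simp
  with d(3) show "has_pd_u Y 0 p" by simp
  have "lor (l p) Xu = - f (fst p) * e (fst p)"
    using s'(4) lor_commute[of Xu] by simp
  then have "Xu = (- f (fst p) * e (fst p)) *\<^sub>R l p"
    using lorentz_frame_expand[OF fr, of Xu] s' XYu lor_commute[of Xu] by simp
  with d(1) show "has_pd_u X ((- f (fst p) * e (fst p)) *\<^sub>R l p) p" by simp
  have "lor Xv (Y p) = - j (fst p) * sqrt (G_coef z p) / e (fst p)"
    unfolding Xv by (simp add: lor.scaleR_left lor.minus_left g[OF p])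
  then have "lor (X p) Yv = j (fst p) * sqrt (G_coef z p) / e (fst p)"
    using s'(7) by simp
  then have "Yv = (- j (fst p) * sqrt (G_coef z p) / e (fst p)) *\<^sub>R X p + (g (fst p) * sqrt (G_coef z p)) *\<^sub>R l p"
    using lorentz_frame_expand[OF fr, of Yv] s' lor_commute[of Yv] by simp
  with d(4) show "has_pd_v Y ((- j (fst p) * sqrt (G_coef z p) / e (fst p)) *\<^sub>R X p +
      (g (fst p) * sqrt (G_coef z p)) *\<^sub>R l p) p" by simp
qed

end

section \<open>Existence\<close>

lemma open_interval_antiderivative:
  fixes g :: "real \<Rightarrow> real"
  assumes "continuous_on {a<..<b} g" "c \<in> {a<..<b}"
  shows "\<exists>G. G c = y \<and> (\<forall>x\<in>{a<..<b}. (G has_vector_derivative g x) (at x))"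
proof -
  have "\<exists>G. \<forall>x::real. ereal a < x \<longrightarrow> x < ereal b \<longrightarrow> (G has_vector_derivative g x) (at x)"
  proof (rule einterval_antiderivative)
    show "ereal a < ereal b" using assms(2) by auto
    show "isCont g x" if "ereal a < ereal x" "ereal x < ereal b" for x
      using assms(1) that by (simp add: continuous_on_eq_continuous_at)
  qed
  then have "\<exists>G. \<forall>x\<in>{a<..<b}. (G has_vector_derivative g x) (at x)" by (simp add: Ball_def imp_conjL)
  then obtain G where "\<forall>x\<in>{a<..<b}. (G has_vector_derivative g x) (at x)" ..
  then show ?thesis
    by (intro exI[of _ "\<lambda>x. G x - G c + y"])
      (auto intro!: has_vector_derivative_add_const[THEN iffD2] has_vector_derivative_diff_const[THEN iffD2])
qed

lemma real_zero_derivative_constant: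
  fixes F :: "real \<Rightarrow> real"
  assumes "convex A" "\<And>x. x \<in> A \<Longrightarrow> (F has_vector_derivative 0) (at x)" "x \<in> A" "y \<in> A"
  shows "F x = F y"
  using has_vector_derivative_zero_constant[OF assms(1), of F] assms(2-)
    has_vector_derivative_at_within by metis

lemma ck_antiderivative:
  assumes "open T" "ck k T \<phi>'" "\<And>x. x \<in> T \<Longrightarrow> (\<phi> has_vector_derivative \<phi>' x) (at x)"
  shows "ck k T \<phi>"
  unfolding ck_def
proof (intro allI impI)
  fix n assume "enat n \<le> k"
  then have "ck_nat (Suc n) T \<phi>"
    unfolding ck_nat_Suc_real[OF assms(1)] using assms(2,3) by (intro exI[of _ \<phi>']) (auto simp: ck_def)
  then show "ck_nat n T \<phi>" by (rule ck_nat_Suc_imp)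
qed

text \<open>\<open>C\<close> and \<open>S\<close> solve \<open>y'' = m y\<close>: hyperbolic
  functions, polynomials or circular functions according to the sign of \<open>m\<close>.
  \<open>V\<close> replaces \<open>(C - 1) / m\<close>, which would be undefined at
  \<open>m = 0\<close>, and the last identity replaces \<open>C^2 - m S^2 = 1\<close>.\<close>

lemma generalized_trigonometric:
  fixes m :: real
  obtains C S V :: "real \<Rightarrow> real" where
    "\<And>t. (C has_vector_derivative m * S t) (at t)" "\<And>t. (S has_vector_derivative C t) (at t)"
    "\<And>t. (V has_vector_derivative S t) (at t)" "\<And>t. C t = 1 + m * V t"
    "\<And>t. (S t)\<^sup>2 = 2 * V t + m * (V t)\<^sup>2"
proof -
  have "\<exists>C S V. (\<forall>t. (C has_vector_derivative m * S t) (at t)) \<and> (\<forall>t. (S has_vector_derivative C t) (at t)) \<and>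
    (\<forall>t. (V has_vector_derivative S t) (at t)) \<and> C 0 = 1 \<and> S 0 = 0 \<and> V 0 = 0"
  proof (cases m "0::real" rule: linorder_cases)
    case equal
    then show ?thesis
      by (intro exI[of _ "\<lambda>t. 1"] exI[of _ "\<lambda>t. t"] exI[of _ "\<lambda>t. t\<^sup>2 / 2"])
        (auto simp: has_real_derivative_iff_has_vector_derivative[symmetric] intro!: derivative_eq_intros)
  next
    case greater
    define r where "r = sqrt m"
    have r: "r > 0" "m = r * r" using greater by (auto simp: r_def)
    then show ?thesis
      by (intro exI[of _ "\<lambda>t. cosh (r * t)"] exI[of _ "\<lambda>t. sinh (r * t) / r"]
          exI[of _ "\<lambda>t. (cosh (r * t) - 1) / (r * r)"])
        (auto simp: has_real_derivative_iff_has_vector_derivative[symmetric] intro!: derivative_eq_intros)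
  next
    case less
    define r where "r = sqrt (- m)"
    have r: "r > 0" "m = - (r * r)" using less by (auto simp: r_def)
    then show ?thesis
      by (intro exI[of _ "\<lambda>t. cos (r * t)"] exI[of _ "\<lambda>t. sin (r * t) / r"]
          exI[of _ "\<lambda>t. (1 - cos (r * t)) / (r * r)"])
        (auto simp: has_real_derivative_iff_has_vector_derivative[symmetric] intro!: derivative_eq_intros)
  qed
  then obtain C S V where d: "\<And>t. (C has_vector_derivative m * S t) (at t)"
    "\<And>t. (S has_vector_derivative C t) (at t)" "\<And>t. (V has_vector_derivative S t) (at t)"
    and 0: "C 0 = 1" "S 0 = 0" "V 0 = 0" by blast
  note r = d[folded has_real_derivative_iff_has_vector_derivative]
  have C: "C t = 1 + m * V t" for t
  proof -
    have "C t - m * V t = C 0 - m * V 0"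
      by (rule real_zero_derivative_constant[of UNIV "\<lambda>t. C t - m * V t"])
        (auto simp: has_real_derivative_iff_has_vector_derivative[symmetric] intro!: derivative_eq_intros r)
    then show ?thesis using 0 by simp
  qed
  have "(S t)\<^sup>2 - 2 * V t - m * (V t)\<^sup>2 = (S 0)\<^sup>2 - 2 * V 0 - m * (V 0)\<^sup>2" for t
    by (rule real_zero_derivative_constant[of UNIV "\<lambda>t. (S t)\<^sup>2 - 2 * V t - m * (V t)\<^sup>2"])
      (auto simp: has_real_derivative_iff_has_vector_derivative[symmetric] C algebra_simps intro!: derivative_eq_intros r)
  then have "(S t)\<^sup>2 = 2 * V t + m * (V t)\<^sup>2" for t
    using 0 by (simp add: algebra_simps)
  with that d C show ?thesis by blast
qed

text \<open>All assumptions are polynomial relations, so the Gram entries and the determinant are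
  decided by \<open>algebra\<close> for every sign of \<open>m\<close> at once. The vector formed
  with \<open>h0\<close> and \<open>n0\<close> has \<open>lor\<close> square
  \<open>- m\<close>.\<close>

lemma rotational_frame_orthonormal:
  fixes h n h0 n0 m c s C S V :: real
  assumes cs: "c\<^sup>2 = 1 + s\<^sup>2" and h: "h = h0 * c + n0 * s" and n: "n = n0 * c + h0 * s"
    and m: "m = h0\<^sup>2 - n0\<^sup>2" and C: "C = 1 + m * V" and S: "S\<^sup>2 = 2 * V + m * V\<^sup>2"
  defines "W \<equiv> S *\<^sub>R axis 1 1 + V *\<^sub>R (h0 *\<^sub>R axis 3 1 + n0 *\<^sub>R axis 2 1)"
  shows "lorentz_frame (c *\<^sub>R axis 3 1 - s *\<^sub>R axis 2 1 + h *\<^sub>R W)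
    (C *\<^sub>R axis 1 1 + S *\<^sub>R (h0 *\<^sub>R axis 3 1 + n0 *\<^sub>R axis 2 1))
    (c *\<^sub>R axis 2 1 - s *\<^sub>R axis 3 1 - n *\<^sub>R W)" (is "lorentz_frame ?X ?Y ?l")
proof -
  have X: "?X $ 1 = h * S" "?X $ 2 = h * V * n0 - s" "?X $ 3 = h * V * h0 + c"
    and Y: "?Y $ 1 = C" "?Y $ 2 = S * n0" "?Y $ 3 = S * h0"
    and l: "?l $ 1 = - n * S" "?l $ 2 = c - n * V * n0" "?l $ 3 = - s - n * V * h0"
    by (simp_all add: W_def axis_def algebra_simps)
  show ?thesis unfolding lorentz_frame_def
  proof (intro conjI)
    show "lor ?X ?X = -1" unfolding lor_def X using assms(1-6) by algebra
    show "lor ?Y ?Y = 1" unfolding lor_def Y using assms(1-6) by algebra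
    show "lor ?l ?l = 1" unfolding lor_def l using assms(1-6) by algebra
    show "lor ?X ?Y = 0" unfolding lor_def X Y using assms(1-6) by algebra
    show "lor ?X ?l = 0" unfolding lor_def X l using assms(1-6) by algebra
    show "lor ?Y ?l = 0" unfolding lor_def Y l using assms(1-6) by algebra
    have "det (vector [?X, ?Y, ?l] :: real^3^3) = 1"
      unfolding det_3 vector_3 X Y l using assms(1-6) by algebra
    then show "det (vector [?X, ?Y, ?l] :: real^3^3) > 0" by simp
  qed
qed

text \<open>A hyperbolic rotation is undone by the opposite one, and it preserves the form
  \<open>h^2 - n^2\<close>.\<close>

lemma hyperbolic_rotation_inverse:
  fixes h n h0 n0 c s :: real
  assumes "h * c - n * s = h0" "n * c - h * s = n0" "c\<^sup>2 = 1 + s\<^sup>2"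
  shows "h = h0 * c + n0 * s" "n = n0 * c + h0 * s" "h\<^sup>2 - n\<^sup>2 = h0\<^sup>2 - n0\<^sup>2"
proof -
  have "h0 * c + n0 * s = h * (c\<^sup>2 - s\<^sup>2)" "n0 * c + h0 * s = n * (c\<^sup>2 - s\<^sup>2)"
    "h0\<^sup>2 - n0\<^sup>2 = (h\<^sup>2 - n\<^sup>2) * (c\<^sup>2 - s\<^sup>2)"
    unfolding assms(1,2)[symmetric] by (simp_all add: algebra_simps power2_eq_square)
  then show "h = h0 * c + n0 * s" "n = n0 * c + h0 * s" "h\<^sup>2 - n\<^sup>2 = h0\<^sup>2 - n0\<^sup>2"
    using assms(3) by simp_all
qed

lemma rotational_surface_exists:
  fixes e q h n f :: "real \<Rightarrow> real" and a b u0 :: real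
  defines "A \<equiv> {a<..<b}"
  assumes u0: "u0 \<in> A" and k: "ck k A e" "ck k A f" "ck k A q"
    and q: "\<And>u. u \<in> A \<Longrightarrow> (q has_vector_derivative e u * h u) (at u)"
    and h: "\<And>u. u \<in> A \<Longrightarrow> (h has_vector_derivative f u * e u * n u) (at u)"
    and n: "\<And>u. u \<in> A \<Longrightarrow> (n has_vector_derivative f u * e u * h u) (at u)"
  obtains z X Y l where "ck k (A \<times> UNIV) z"
    "adapted_frame (A \<times> UNIV) (\<lambda>p. e (fst p)) (\<lambda>p. q (fst p)) (\<lambda>p. h (fst p))
      (\<lambda>p. - f (fst p) * e (fst p)) (\<lambda>p. n (fst p)) z X Y l"
proof -
  have A: "open A" "convex A" by (auto simp: A_def)
  have ck_mult: "ck k A (\<lambda>x. F x * G x)" if "ck k A F" "ck k A G" for F G :: "real \<Rightarrow> real"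
    using that ck_nat_bilinear[OF bounded_bilinear_mult A(1)] unfolding ck_def by blast
  have anti: "\<exists>G. G u0 = 0 \<and> (\<forall>x\<in>A. (G has_vector_derivative g x) (at x)) \<and> ck k A G" if "ck k A g" for g :: "real \<Rightarrow> real"
  proof -
    have "continuous_on A g" using that[unfolded ck_def, rule_format, of 0] by (simp add: enat_0)
    then obtain G where "G u0 = 0" "\<forall>x\<in>A. (G has_vector_derivative g x) (at x)"
      using open_interval_antiderivative[of a b g u0 0] u0 unfolding A_def by blast
    with ck_antiderivative[OF A(1) that] show ?thesis by blast
  qed
  obtain \<theta> where \<theta>: "\<theta> u0 = 0" "\<And>x. x \<in> A \<Longrightarrow> (\<theta> has_vector_derivative f x * e x) (at x)" "ck k A \<theta>"
    using anti[OF ck_mult[OF k(2,1)]] by blast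
  have ck_exp: "ck k A (\<lambda>x. exp (g x))" if "ck k A g" for g :: "real \<Rightarrow> real"
    using that ck_nat_compose[OF A(1) open_UNIV _ _ ck_nat_exp] unfolding ck_def by blast
  have ck_lin: "ck k A (\<lambda>x. r * F x)" if "ck k A F" for F :: "real \<Rightarrow> real" and r
    using that ck_nat_bounded_linear[OF bounded_linear_mult_right A(1)] unfolding ck_def by blast
  have ck_add: "ck k A (\<lambda>x. F x + G x)" if "ck k A F" "ck k A G" for F G :: "real \<Rightarrow> real"
    using that ck_nat_add[OF A(1)] unfolding ck_def by blast
  \<comment> \<open>\<open>cosh\<close> and \<open>sinh\<close> are spelled out with
    \<open>exp\<close>, for which the composition rule is available; the factor \<open>- 1\<close>
    puts the negative exponent into the form of \<open>ck_lin\<close>.\<close>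
  have "ck k A (\<lambda>x. e x * (exp (\<theta> x) * (1/2) + (1/2) * exp (- 1 * \<theta> x)))"
    "ck k A (\<lambda>x. e x * (exp (\<theta> x) * (1/2) + (- 1/2) * exp (- 1 * \<theta> x)))"
    unfolding mult.commute[of "exp _" "1/2"]
    by (intro ck_mult ck_add ck_exp ck_lin \<theta> k)+
  then have ch: "ck k A (\<lambda>x. e x * cosh (\<theta> x))" and sh: "ck k A (\<lambda>x. e x * sinh (\<theta> x))"
    by (simp_all add: cosh_field_def sinh_field_def diff_divide_distrib add_divide_distrib)
  obtain P Q where PQ: "\<And>x. x \<in> A \<Longrightarrow> (P has_vector_derivative e x * cosh (\<theta> x)) (at x)"
    "\<And>x. x \<in> A \<Longrightarrow> (Q has_vector_derivative e x * sinh (\<theta> x)) (at x)" "ck k A P" "ck k A Q"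
    using anti[OF ch] anti[OF sh] by blast
  \<comment> \<open>Initial values at \<open>u0\<close>, where \<open>\<theta>\<close> vanishes.
    From \<open>h' = \<theta>' n\<close> and \<open>n' = \<theta>' h\<close>, the pair
    \<open>(h, n)\<close> is the initial pair rotated hyperbolically by \<open>\<theta>\<close>;
    thus \<open>m\<close> is a first integral.\<close>
  define h0 where "h0 = h u0"
  define n0 where "n0 = n u0"
  define m where "m = h0\<^sup>2 - n0\<^sup>2"
  note real = has_real_derivative_iff_has_vector_derivative
  note dr = q[folded real] h[folded real] n[folded real] \<theta>(2)[folded real] PQ(1,2)[folded real]
  have h0: "h u * cosh (\<theta> u) - n u * sinh (\<theta> u) = h0" if "u \<in> A" for u
  proof -
    have "h u * cosh (\<theta> u) - n u * sinh (\<theta> u) = h u0 * cosh (\<theta> u0) - n u0 * sinh (\<theta> u0)"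
      by (rule real_zero_derivative_constant[OF A(2) _ that u0, of "\<lambda>u. h u * cosh (\<theta> u) - n u * sinh (\<theta> u)"])
        (auto simp: real[symmetric] algebra_simps intro!: derivative_eq_intros dr)
    then show ?thesis by (simp add: \<theta> h0_def n0_def)
  qed
  have n0: "n u * cosh (\<theta> u) - h u * sinh (\<theta> u) = n0" if "u \<in> A" for u
  proof -
    have "n u * cosh (\<theta> u) - h u * sinh (\<theta> u) = n u0 * cosh (\<theta> u0) - h u0 * sinh (\<theta> u0)"
      by (rule real_zero_derivative_constant[OF A(2) _ that u0, of "\<lambda>u. n u * cosh (\<theta> u) - h u * sinh (\<theta> u)"])
        (auto simp: real[symmetric] algebra_simps intro!: derivative_eq_intros dr)
    then show ?thesis by (simp add: \<theta> h0_def n0_def)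
  qed
  have cs: "(cosh t)\<^sup>2 = 1 + (sinh t)\<^sup>2" for t :: real
    using hyperbolic_pythagoras[of t] by simp
  have hn: "h u = h0 * cosh (\<theta> u) + n0 * sinh (\<theta> u)" "n u = n0 * cosh (\<theta> u) + h0 * sinh (\<theta> u)"
    and m: "(h u)\<^sup>2 - (n u)\<^sup>2 = m" if "u \<in> A" for u
    using hyperbolic_rotation_inverse[OF h0[OF that] n0[OF that] cs] unfolding m_def by blast+
  obtain C S V where CSV: "\<And>t. (C has_vector_derivative m * S t) (at t)"
    "\<And>t. (S has_vector_derivative C t) (at t)" "\<And>t. (V has_vector_derivative S t) (at t)"
    and C: "\<And>t. C t = 1 + m * V t" and S: "\<And>t. (S t)\<^sup>2 = 2 * V t + m * (V t)\<^sup>2"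
    using generalized_trigonometric by blast
  define e1 e2 e3 :: "real^3" where "e1 = axis 1 1" and "e2 = axis 2 1" and "e3 = axis 3 1"
  \<comment> \<open>The value of \<open>h X + n l\<close> wherever \<open>W\<close> vanishes. In
    general \<open>h X + n l = w + m W\<close>, as checked below.\<close>
  define w where "w = h0 *\<^sub>R e3 + n0 *\<^sub>R e2"
  define W where "W v = S v *\<^sub>R e1 + V v *\<^sub>R w" for v
  define Y where "Y v = C v *\<^sub>R e1 + S v *\<^sub>R w" for v
  define X where "X p = cosh (\<theta> (fst p)) *\<^sub>R e3 - sinh (\<theta> (fst p)) *\<^sub>R e2 + h (fst p) *\<^sub>R W (snd p)" for p
  define l where "l p = cosh (\<theta> (fst p)) *\<^sub>R e2 - sinh (\<theta> (fst p)) *\<^sub>R e3 - n (fst p) *\<^sub>R W (snd p)" for p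
  define z where "z p = P (fst p) *\<^sub>R e3 - Q (fst p) *\<^sub>R e2 + q (fst p) *\<^sub>R W (snd p)" for p
  have W: "(W has_vector_derivative Y v) (at v)" for v
    unfolding W_def Y_def by (auto intro!: derivative_eq_intros CSV[folded real])
  have dc: "((\<lambda>u. cosh (\<theta> u)) has_real_derivative sinh (\<theta> u) * (f u * e u)) (at u)"
    "((\<lambda>u. sinh (\<theta> u)) has_real_derivative cosh (\<theta> u) * (f u * e u)) (at u)" if "u \<in> A" for u
    using dr(4)[OF that] by (auto intro!: derivative_eq_intros)
  have "adapted_frame (A \<times> UNIV) (\<lambda>p. e (fst p)) (\<lambda>p. q (fst p)) (\<lambda>p. h (fst p))
      (\<lambda>p. - f (fst p) * e (fst p)) (\<lambda>p. n (fst p)) z X (\<lambda>p. Y (snd p)) l"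
    unfolding adapted_frame_def
  proof (intro ballI conjI)
    fix p assume "p \<in> A \<times> (UNIV :: real set)"
    then have p: "fst p \<in> A" by auto
    let ?u = "fst p" and ?v = "snd p"
    show "lorentz_frame (X p) (Y ?v) (l p)"
      unfolding X_def Y_def l_def W_def w_def e1_def e2_def e3_def
      by (rule rotational_frame_orthonormal[OF cs hn[OF p] m_def C S])
    show "has_pd_u z (e ?u *\<^sub>R X p) p"
      unfolding z_def X_def has_pd_u_def
      by (auto simp: algebra_simps intro!: derivative_eq_intros dr p)
    show "has_pd_v z (q ?u *\<^sub>R Y ?v) p"
      unfolding z_def has_pd_v_def by (auto intro!: derivative_eq_intros W)
    show "has_pd_u X ((- f ?u * e ?u) *\<^sub>R l p) p"
      unfolding X_def l_def has_pd_u_def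
      by (auto simp: algebra_simps intro!: derivative_eq_intros dc dr p)
    show "has_pd_v X (h ?u *\<^sub>R Y ?v) p"
      unfolding X_def has_pd_v_def by (auto intro!: derivative_eq_intros W)
    show "has_pd_u (\<lambda>p. Y (snd p)) 0 p" by (rule has_pd_u_snd)
    have "(Y has_vector_derivative (m * S ?v) *\<^sub>R e1 + C ?v *\<^sub>R w) (at ?v)"
      unfolding Y_def by (auto intro!: derivative_eq_intros CSV[folded real])
    \<comment> \<open>Collected by \<open>e3\<close>, \<open>e2\<close> and \<open>W\<close>, the
      coefficients of the right side are the constants \<open>h0\<close>, \<open>n0\<close> and
      \<open>m\<close>. It is therefore independent of \<open>u\<close>, as the derivative of a
      function of \<open>v\<close> must be.\<close>
    moreover have "(m * S ?v) *\<^sub>R e1 + C ?v *\<^sub>R w = h ?u *\<^sub>R X p + n ?u *\<^sub>R l p"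
    proof -
      have "h ?u *\<^sub>R X p + n ?u *\<^sub>R l p = (h ?u * cosh (\<theta> ?u) - n ?u * sinh (\<theta> ?u)) *\<^sub>R e3 +
          (n ?u * cosh (\<theta> ?u) - h ?u * sinh (\<theta> ?u)) *\<^sub>R e2 + ((h ?u)\<^sup>2 - (n ?u)\<^sup>2) *\<^sub>R W ?v"
        by (simp add: X_def l_def algebra_simps power2_eq_square)
      also have "\<dots> = w + m *\<^sub>R W ?v" by (simp add: h0[OF p] n0[OF p] m[OF p] w_def)
      also have "\<dots> = (m * S ?v) *\<^sub>R e1 + C ?v *\<^sub>R w" by (simp add: W_def C algebra_simps)
      finally show ?thesis by simp
    qed
    ultimately show "has_pd_v (\<lambda>p. Y (snd p)) (h ?u *\<^sub>R X p + n ?u *\<^sub>R l p) p"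
      using has_pd_v_snd[of Y] by simp
    show "has_pd_u l ((- f ?u * e ?u) *\<^sub>R X p) p"
      unfolding X_def l_def has_pd_u_def
      by (auto simp: algebra_simps intro!: derivative_eq_intros dc dr p)
    show "has_pd_v l (- n ?u *\<^sub>R Y ?v) p"
      unfolding l_def has_pd_v_def by (auto intro!: derivative_eq_intros W)
  qed
  moreover have "ck k (A \<times> UNIV) z"
    unfolding ck_def
  proof (intro allI impI)
    fix i assume i: "enat i \<le> k"
    \<comment> \<open>The system \<open>C' = m S\<close>, \<open>S' = C\<close>,
      \<open>V' = S\<close> is closed, so the three functions gain orders of smoothness only
      jointly.\<close>
    have "ck_nat i UNIV S \<and> ck_nat i UNIV C \<and> ck_nat i UNIV V"
    proof (induction i)
      case 0
      then show ?case
        using CSV by (auto intro!: continuous_at_imp_continuous_on has_vector_derivative_continuous)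
    next
      case (Suc i)
      have "ck_nat i UNIV (\<lambda>t. m * S t)"
        using Suc ck_nat_bounded_linear[OF bounded_linear_mult_right open_UNIV] by blast
      then have "ck_nat (Suc i) UNIV C"
        unfolding ck_nat_Suc_real[OF open_UNIV] using CSV by (intro exI[of _ "\<lambda>t. m * S t"]) simp
      moreover have "ck_nat (Suc i) UNIV S"
        unfolding ck_nat_Suc_real[OF open_UNIV] using CSV Suc by (intro exI[of _ C]) simp
      moreover have "ck_nat (Suc i) UNIV V"
        unfolding ck_nat_Suc_real[OF open_UNIV] using CSV Suc by (intro exI[of _ S]) simp
      ultimately show ?case by blast
    qed
    then have SV: "ck_nat i UNIV S" "ck_nat i UNIV V" by auto
    let ?R = "A \<times> (UNIV :: real set)"
    have R: "open ?R" using A by (intro open_Times) auto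
    have fst: "ck_nat i ?R (\<lambda>p. F (fst p))" if "ck k A F" for F :: "real \<Rightarrow> real"
    proof (rule ck_nat_compose[where \<phi> = fst and \<psi> = F, OF R A(1)])
      show "ck_nat i ?R fst"
        using ck_nat_bounded_linear[OF bounded_linear_fst R ck_nat_id[OF R]] by simp
    qed (use that i in \<open>auto simp: ck_def\<close>)
    have snd: "ck_nat i ?R (\<lambda>p. F (snd p))" if "ck_nat i UNIV F" for F :: "real \<Rightarrow> real"
    proof (rule ck_nat_compose[where \<phi> = snd and \<psi> = F, OF R open_UNIV])
      show "ck_nat i ?R snd"
        using ck_nat_bounded_linear[OF bounded_linear_snd R ck_nat_id[OF R]] by simp
    qed (use that in auto)
    have "ck_nat i ?R (\<lambda>p. P (fst p) *\<^sub>R e3 + Q (fst p) *\<^sub>R (- e2) +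
        q (fst p) *\<^sub>R (S (snd p) *\<^sub>R e1 + V (snd p) *\<^sub>R w))"
      by (intro ck_nat_add ck_nat_bilinear[OF bounded_bilinear_scaleR] ck_nat_const R fst snd PQ SV k)
    then show "ck_nat i ?R z" unfolding z_def[abs_def] W_def by simp
  qed
  ultimately show ?thesis using that by blast
qed

section \<open>Congruence of surfaces with the same profile\<close>

lemma open_contains_square:
  fixes R :: "(real \<times> real) set"
  assumes "open R" "(u, v) \<in> R"
  obtains d where "d > 0" "{u - d<..<u + d} \<times> {v - d<..<v + d} \<subseteq> R"
proof -
  obtain A B where AB: "open A" "open B" "u \<in> A" "v \<in> B" "A \<times> B \<subseteq> R"
    by (rule open_prod_elim[OF assms]) blast
  obtain d1 d2 where d: "d1 > 0" "ball u d1 \<subseteq> A" "d2 > 0" "ball v d2 \<subseteq> B"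
    by (metis AB openE)
  have "{u - min d1 d2<..<u + min d1 d2} \<times> {v - min d1 d2<..<v + min d1 d2} \<subseteq> ball u d1 \<times> ball v d2"
    by (auto simp: dist_real_def)
  with d AB that[of "min d1 d2"] show ?thesis by force
qed

lemma ck_nat_le: "ck k S F \<Longrightarrow> enat n \<le> k \<Longrightarrow> ck_nat n S F"
  by (simp add: ck_def)

lemma ck_exp_compose:
  fixes F :: "real \<Rightarrow> real"
  shows "open T \<Longrightarrow> ck k T F \<Longrightarrow> ck k T (\<lambda>x. exp (F x))"
  using ck_nat_compose[OF _ open_UNIV _ _ ck_nat_exp, of T F] by (simp add: ck_def)

lemma ck_cmult:
  fixes F :: "real \<Rightarrow> real"
  shows "open T \<Longrightarrow> ck k T F \<Longrightarrow> ck k T (\<lambda>x. c * F x)"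
  using ck_nat_bounded_linear[OF bounded_linear_mult_right, of T _ F c] by (simp add: ck_def)

lemma ck_open_subset: "ck k S F \<Longrightarrow> open T \<Longrightarrow> T \<subseteq> S \<Longrightarrow> ck k T F"
  unfolding ck_def using ck_nat_open_subset by blast

text \<open>The problem reduced to one variable: \<open>F\<close> and \<open>G\<close> are the
  prescribed curvatures as functions of \<open>u\<close>. The integrals enter through differential
  conditions alone, so the interval of the Weingarten functions is no longer visible.\<close>

locale weingarten_profile =
  fixes k :: enat and \<Omega> :: "real set" and F G I J :: "real \<Rightarrow> real" and a :: real
  assumes k: "3 \<le> k" and \<Omega>: "open \<Omega>" and a: "a > 0"
    and ck: "ck k \<Omega> F" "ck k \<Omega> G" "ck k \<Omega> I" "ck k \<Omega> J"
    and FG: "\<And>u. u \<in> \<Omega> \<Longrightarrow> F u \<noteq> G u"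
    and codazzi: "\<And>u. u \<in> \<Omega> \<Longrightarrow> (G has_real_derivative deriv J u * (G u - F u)) (at u)"
    and J0: "\<And>u. u \<in> \<Omega> \<Longrightarrow> deriv J u \<noteq> 0"
    and gauss: "\<And>u. u \<in> \<Omega> \<Longrightarrow>
      a\<^sup>2 * exp (2 * I u) * (deriv (deriv J) u + deriv I u * deriv J u - (deriv J u)\<^sup>2) = - (F u * G u)"
begin

definition "e u = exp (- I u) / a"
definition "q u = exp (- J u)"
definition "h u = - deriv J u * q u / e u"
definition "n u = G u * q u"

lemma e_pos: "e u > 0" and q_pos: "q u > 0"
  using a by (auto simp: e_def q_def)

lemma enat_le_k: "i \<le> 3 \<Longrightarrow> enat i \<le> k"
proof -
  assume "i \<le> 3"
  then have "enat i \<le> enat 3" by simp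
  also have "enat 3 \<le> k" using k by (simp add: numeral_eq_enat)
  finally show ?thesis .
qed

lemma ck_e: "ck k \<Omega> e" and ck_q: "ck k \<Omega> q"
proof -
  have "ck k \<Omega> (\<lambda>x. (1 / a) * exp (- 1 * I x))" "ck k \<Omega> (\<lambda>x. exp (- 1 * J x))"
    by (intro ck_cmult ck_exp_compose ck \<Omega>)+
  then show "ck k \<Omega> e" "ck k \<Omega> q" by (simp_all add: e_def[abs_def] q_def[abs_def])
qed

lemma
  shows I_deriv: "u \<in> \<Omega> \<Longrightarrow> (I has_real_derivative deriv I u) (at u)"
    and J_deriv: "u \<in> \<Omega> \<Longrightarrow> (J has_real_derivative deriv J u) (at u)"
    and J_deriv2: "u \<in> \<Omega> \<Longrightarrow> (deriv J has_real_derivative deriv (deriv J) u) (at u)"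
    and J_cont: "continuous_on \<Omega> (deriv J)"
proof -
  have "ck_nat (Suc 0) \<Omega> I" "ck_nat (Suc (Suc 0)) \<Omega> J"
    using ck enat_le_k[of 1] enat_le_k[of 2] unfolding ck_def One_nat_def numeral_2_eq_2 by auto
  then obtain I1 J1 where I1: "\<forall>u\<in>\<Omega>. (I has_vector_derivative I1 u) (at u)"
    and J1: "\<forall>u\<in>\<Omega>. (J has_vector_derivative J1 u) (at u)" "ck_nat (Suc 0) \<Omega> J1"
    unfolding ck_nat_Suc_real[OF \<Omega>] by blast
  note vd = has_real_derivative_iff_has_vector_derivative[symmetric]
  show "u \<in> \<Omega> \<Longrightarrow> (I has_real_derivative deriv I u) (at u)"
    using I1 DERIV_imp_deriv unfolding vd by metis
  have eq: "J1 u = deriv J u" if "u \<in> \<Omega>" for u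
    using J1 that DERIV_imp_deriv unfolding vd by metis
  then show "u \<in> \<Omega> \<Longrightarrow> (J has_real_derivative deriv J u) (at u)"
    using J1 unfolding vd by metis
  have J2: "ck_nat (Suc 0) \<Omega> (deriv J)" using ck_nat_cong[OF J1(2) eq] .
  then obtain J2 where "\<forall>u\<in>\<Omega>. (deriv J has_vector_derivative J2 u) (at u)"
    unfolding ck_nat_Suc_real[OF \<Omega>] by blast
  then show "u \<in> \<Omega> \<Longrightarrow> (deriv J has_real_derivative deriv (deriv J) u) (at u)"
    using DERIV_imp_deriv unfolding vd by metis
  show "continuous_on \<Omega> (deriv J)" using J2 ck_nat_continuous_on by blast
qed

lemma q_deriv: "u \<in> \<Omega> \<Longrightarrow> (q has_real_derivative - deriv J u * q u) (at u)"
  and e_deriv: "u \<in> \<Omega> \<Longrightarrow> (e has_real_derivative - deriv I u * e u) (at u)"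
  unfolding q_def[abs_def] e_def[abs_def] using a by (auto intro!: derivative_eq_intros I_deriv J_deriv)

text \<open>The Gauss equation, as the compatibility condition \<open>X\<^sub>u\<^sub>v = X\<^sub>v\<^sub>u\<close> of the frame.\<close>

lemma h_deriv: assumes "u \<in> \<Omega>" shows "(h has_real_derivative F u * e u * n u) (at u)"
proof -
  \<comment> \<open>In this form, free of a variable denominator, one differentiation produces the
    bracket of \<open>gauss\<close>.\<close>
  have "h = (\<lambda>u. - a * deriv J u * exp (I u - J u))"
    using a by (auto simp: h_def[abs_def] q_def e_def exp_minus exp_diff field_simps)
  moreover have "((\<lambda>u. - a * deriv J u * exp (I u - J u)) has_real_derivative
     - a * exp (I u - J u) * (deriv (deriv J) u + deriv I u * deriv J u - (deriv J u)\<^sup>2)) (at u)"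
    using assms by (auto simp: algebra_simps power2_eq_square intro!: derivative_eq_intros I_deriv J_deriv J_deriv2)
  \<comment> \<open>Splitting \<open>exp (I - J)\<close> as
    \<open>exp (2 * I) * exp (- I) * exp (- J)\<close> restores the factor in \<open>gauss\<close>;
    the rest is \<open>e * q\<close>.\<close>
  moreover have "- a * exp (I u - J u) * (deriv (deriv J) u + deriv I u * deriv J u - (deriv J u)\<^sup>2) =
    - (a\<^sup>2 * exp (2 * I u) * (deriv (deriv J) u + deriv I u * deriv J u - (deriv J u)\<^sup>2)) * (e u * q u)"
  proof -
    have "a * exp (I u - J u) = a\<^sup>2 * (exp (2 * I u) * exp (- I u) * exp (- J u)) / a"
      using a by (simp add: exp_add[symmetric] power2_eq_square)
    also have "\<dots> = a\<^sup>2 * exp (2 * I u) * (e u * q u)" by (simp add: e_def q_def)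
    finally show ?thesis by (simp add: mult_ac)
  qed
  ultimately show ?thesis unfolding gauss[OF assms] by (simp add: n_def mult_ac)
qed

text \<open>The terms in \<open>G\<close> cancel:
  \<open>(G q)' = J' (G - F) q - G J' q = - F J' q\<close>, and \<open>- J' q = e h\<close>.\<close>

lemma n_deriv: assumes "u \<in> \<Omega>" shows "(n has_real_derivative F u * e u * h u) (at u)"
  unfolding n_def[abs_def] using assms e_pos[of u]
  by (auto simp: h_def algebra_simps intro!: derivative_eq_intros codazzi q_deriv)

text \<open>The frame fields are hidden because comparisons use only their coefficients. These carry
  the normalization \<open>sqrt G = q\<close>, with no factor in \<open>v\<close>.\<close>

definition "frame_on R z \<longleftrightarrow> (\<exists>X Y l. adapted_frame R (\<lambda>p. e (fst p)) (\<lambda>p. q (fst p)) (\<lambda>p. h (fst p))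
      (\<lambda>p. - F (fst p) * e (fst p)) (\<lambda>p. n (fst p)) z X Y l)"

lemma surface_exists:
  assumes "u0 \<in> {b<..<c}" "{b<..<c} \<subseteq> \<Omega>"
  shows "\<exists>z. ck k ({b<..<c} \<times> UNIV) z \<and> frame_on ({b<..<c} \<times> UNIV) z"
proof -
  note s = ck_open_subset[OF _ open_greaterThanLessThan assms(2)]
  note vd = has_real_derivative_iff_has_vector_derivative[symmetric]
  have d: "(q has_vector_derivative e u * h u) (at u)" "(h has_vector_derivative F u * e u * n u) (at u)"
    "(n has_vector_derivative F u * e u * h u) (at u)" if "u \<in> {b<..<c}" for u
  proof -
    have "e u * h u = - deriv J u * q u" using e_pos[of u] by (simp add: h_def)
    then show "(q has_vector_derivative e u * h u) (at u)" "(h has_vector_derivative F u * e u * n u) (at u)"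
      "(n has_vector_derivative F u * e u * h u) (at u)"
      using q_deriv[of u] h_deriv[of u] n_deriv[of u] that assms(2) unfolding vd by auto
  qed
  show ?thesis
    by (rule rotational_surface_exists[OF assms(1) s[OF ck_e] s[OF ck(1)] s[OF ck_q] d])
      (auto simp: frame_on_def)
qed

lemma frame_on_subset: "frame_on R z \<Longrightarrow> R' \<subseteq> R \<Longrightarrow> frame_on R' z"
  unfolding frame_on_def adapted_frame_def by blast

lemma frame_invariants:
  assumes "frame_on R z" "open R" "fst ` R \<subseteq> \<Omega>" "p \<in> R"
  shows "E_coef z p = - (e (fst p))\<^sup>2" "G_coef z p = (q (fst p))\<^sup>2" "F_coef z p = 0" "M_coef z p = 0"
    "nu1 z p = F (fst p)" "nu2 z p = G (fst p)" "gamma1 z p = 0"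
    "gamma2 z p = a * exp (I (fst p)) * deriv J (fst p)"
proof -
  obtain X Y l where f: "adapted_frame R (\<lambda>p. e (fst p)) (\<lambda>p. q (fst p)) (\<lambda>p. h (fst p))
      (\<lambda>p. - F (fst p) * e (fst p)) (\<lambda>p. n (fst p)) z X Y l"
    using assms(1) frame_on_def by auto
  note vd = has_real_derivative_iff_has_vector_derivative
  have in\<Omega>: "fst p \<in> \<Omega>" if "p \<in> R" for p using that assms(3) by auto
  note * = adapted_frame_invariants[OF f assms(2,4) e_pos e_deriv[OF in\<Omega>, unfolded vd] q_pos
      has_pd_u_fst[OF q_deriv[OF in\<Omega>, unfolded vd]] has_pd_v_fst]
  show "E_coef z p = - (e (fst p))\<^sup>2" "G_coef z p = (q (fst p))\<^sup>2" "F_coef z p = 0" "M_coef z p = 0"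
    "nu1 z p = F (fst p)" "nu2 z p = G (fst p)" "gamma1 z p = 0"
    "gamma2 z p = a * exp (I (fst p)) * deriv J (fst p)"
    using * e_pos[of "fst p"] q_pos[of "fst p"] a by (simp_all add: n_def)
      (simp add: e_def exp_minus field_simps)
qed

lemma frame_timelike:
  assumes "frame_on R z" "open R" "fst ` R \<subseteq> \<Omega>" "ck k R z"
  shows "timelike_surface k R z"
  unfolding timelike_surface_def
proof (intro conjI ballI assms(2,4))
  fix p assume p: "p \<in> R"
  note * = frame_invariants[OF assms(1-3) p]
  show "E_coef z p < 0" "G_coef z p > 0" "F_coef z p = 0" "M_coef z p = 0"
    using * e_pos[of "fst p"] q_pos[of "fst p"] by simp_all
  have "fst p \<in> \<Omega>" using p assms(3) by blast
  then show "nu1 z p \<noteq> nu2 z p" using * FG by simp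
qed

context
  fixes D z
  assumes surf: "timelike_surface k D z" and D: "fst ` D \<subseteq> \<Omega>"
    and nu: "\<And>p. p \<in> D \<Longrightarrow> nu1 z p = F (fst p)" "\<And>p. p \<in> D \<Longrightarrow> nu2 z p = G (fst p)"
    and gamma: "\<And>p. p \<in> D \<Longrightarrow> gamma2 z p = a * exp (I (fst p)) * deriv J (fst p)"
begin

interpretation rotational_timelike k D z F G "\<lambda>u. deriv J u * (G u - F u)" "deriv J" e
proof unfold_locales
  fix p assume p: "p \<in> D"
  then have u: "fst p \<in> \<Omega>" using D by auto
  show "gamma2 z p = deriv J (fst p) / e (fst p)"
    using gamma[OF p] a by (simp add: e_def exp_minus field_simps)
  show "(G has_vector_derivative deriv J (fst p) * (G (fst p) - F (fst p))) (at (fst p))"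
    using codazzi[OF u] by (simp add: has_real_derivative_iff_has_vector_derivative)
  show "deriv J (fst p) \<noteq> 0" "F (fst p) \<noteq> G (fst p)" using J0 FG u by auto
next
  have "continuous_on \<Omega> F" "continuous_on \<Omega> G"
    using ck enat_le_k[of 0] by (auto simp: ck_def)
  then show "continuous_on (fst ` D) F" "continuous_on (fst ` D) G"
    "continuous_on (fst ` D) (\<lambda>u. deriv J u * (G u - F u))"
    using J_cont D by (auto intro!: continuous_intros intro: continuous_on_subset)
qed (use surf k nu e_pos in auto)

text \<open>Naming the facts here carries them out of the interpretation, with the prescribed
  invariants as premises, so that they can be applied to competitors on any domain.\<close>

lemmas surface_frame = adapted and surface_G_pd_u = G_pd_u and surface_G_pos = EG(2)

end

text \<open>Once \<open>sqrt G\<close> equals \<open>q\<close>, the two adapted frames have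
  identical coefficients, and the constant map between them needs no change of
  \<open>v\<close>.\<close>

lemma congruent_if_G_eq:
  assumes surf: "timelike_surface k (A \<times> B) z'" and "A \<subseteq> \<Omega>" "convex A" "convex B" "A \<noteq> {}" "B \<noteq> {}"
    and nu: "\<And>p. p \<in> A \<times> B \<Longrightarrow> nu1 z' p = F (fst p)" "\<And>p. p \<in> A \<times> B \<Longrightarrow> nu2 z' p = G (fst p)"
    and gamma: "\<And>p. p \<in> A \<times> B \<Longrightarrow> gamma2 z' p = a * exp (I (fst p)) * deriv J (fst p)"
    and G: "\<And>p. p \<in> A \<times> B \<Longrightarrow> sqrt (G_coef z' p) = q (fst p)"
    and z: "frame_on (A \<times> B) z"
  shows "\<exists>T. motion T \<and> (\<forall>p\<in>A \<times> B. z' p = T (z p))"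
proof -
  have "fst ` (A \<times> B) \<subseteq> \<Omega>" using assms(2) by auto
  from surface_frame[OF surf this nu gamma]
  have f': "adapted_frame (A \<times> B) (\<lambda>p. e (fst p)) (\<lambda>p. q (fst p)) (\<lambda>p. h (fst p))
      (\<lambda>p. - F (fst p) * e (fst p)) (\<lambda>p. n (fst p)) z' (X_frame z') (Y_frame z') (unit_normal z')"
    by (simp add: adapted_frame_def G h_def n_def)
  obtain X Y l where "adapted_frame (A \<times> B) (\<lambda>p. e (fst p)) (\<lambda>p. q (fst p)) (\<lambda>p. h (fst p))
      (\<lambda>p. - F (fst p) * e (fst p)) (\<lambda>p. n (fst p)) z X Y l"
    using z frame_on_def by auto
  from adapted_frame_congruence[OF assms(3-6) this f'] show ?thesis .
qed

text \<open>The competitor has \<open>sqrt G = c(v) q(u)\<close>. Reparametrizing the model by an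
  antiderivative \<open>\<phi>\<close> of \<open>c\<close> multiplies its coefficients in the
  \<open>v\<close> direction by the same \<open>c\<close>, after which both frames satisfy one
  system.\<close>

lemma congruent_nearI:
  assumes surf: "timelike_surface k D' z'" and D': "fst ` D' \<subseteq> \<Omega>" "(u0, v0) \<in> D'"
    and nu: "\<And>p. p \<in> D' \<Longrightarrow> nu1 z' p = F (fst p)" "\<And>p. p \<in> D' \<Longrightarrow> nu2 z' p = G (fst p)"
    and gamma: "\<And>p. p \<in> D' \<Longrightarrow> gamma2 z' p = a * exp (I (fst p)) * deriv J (fst p)"
    and z: "frame_on D z" and D: "open D" "(u0, v0) \<in> D"
  shows "congruent_near k (u0, v0) D z D' z'"
proof -
  have "open D'" and ck': "ck k D' z'" using surf by (auto simp: timelike_surface_def)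
  have G_u: "has_pd_u (G_coef z') (- 2 * deriv J (fst p) * G_coef z' p) p"
    and G_pos: "G_coef z' p > 0" if "p \<in> D'" for p
    using surface_G_pd_u[OF surf D'(1)] surface_G_pos[OF surf D'(1)] nu gamma that by blast+
  have z'_frame: "adapted_frame D' (\<lambda>p. e (fst p)) (\<lambda>p. sqrt (G_coef z' p))
      (\<lambda>p. - deriv J (fst p) * sqrt (G_coef z' p) / e (fst p)) (\<lambda>p. - F (fst p) * e (fst p))
      (\<lambda>p. G (fst p) * sqrt (G_coef z' p)) z' (X_frame z') (Y_frame z') (unit_normal z')"
    by (rule surface_frame[OF surf D'(1)]) (use nu gamma in auto)
  obtain d where d: "d > 0" "{u0 - d<..<u0 + d} \<times> {v0 - d<..<v0 + d} \<subseteq> D' \<inter> D"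
    using open_contains_square[of "D' \<inter> D" u0 v0] \<open>open D'\<close> D D' by blast
  define A B where "A = {u0 - d<..<u0 + d}" and "B = {v0 - d<..<v0 + d}"
  have AB: "A \<times> B \<subseteq> D'" "A \<times> B \<subseteq> D" "u0 \<in> A" "v0 \<in> B" "open A" "open B" "convex A"
    using d by (auto simp: A_def B_def)
  \<comment> \<open>The ratio of the lengths of the two \<open>v\<close> tangents along the line
    \<open>u = u0\<close>; the next claim shows that it is the same for every other
    \<open>u\<close>.\<close>
  define c where "c v = sqrt (G_coef z' (u0, v)) * (1 / q u0)" for v
  have sqrt_G: "sqrt (G_coef z' p) = c (snd p) * q (fst p)" if pAB: "p \<in> A \<times> B" for p
  proof -
    obtain u v where p: "p = (u, v)" "u \<in> A" "v \<in> B" using pAB by blast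
    \<comment> \<open>For \<open>G_u = - 2 J_u G\<close> the function \<open>exp (2 J)\<close> is an
      integrating factor.\<close>
    have "G_coef z' (u, v) * exp (2 * J u) = G_coef z' (u0, v) * exp (2 * J u0)"
    proof (rule real_zero_derivative_constant[OF \<open>convex A\<close> _ \<open>u \<in> A\<close> \<open>u0 \<in> A\<close>, of "\<lambda>s. G_coef z' (s, v) * exp (2 * J s)"])
      fix s assume s: "s \<in> A"
      then have sD: "(s, v) \<in> D'" "s \<in> \<Omega>" using AB p D' by force+
      have "((\<lambda>s. G_coef z' (s, v)) has_real_derivative - 2 * deriv J s * G_coef z' (s, v)) (at s)"
        using G_u[OF sD(1)] by (simp add: has_pd_u_def has_real_derivative_iff_has_vector_derivative)
      then show "((\<lambda>s. G_coef z' (s, v) * exp (2 * J s)) has_vector_derivative 0) (at s)"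
        unfolding has_real_derivative_iff_has_vector_derivative[symmetric]
        by (auto intro!: derivative_eq_intros J_deriv sD)
    qed
    then have "sqrt (G_coef z' (u, v) * exp (2 * J u)) = sqrt (G_coef z' (u0, v) * exp (2 * J u0))"
      by simp
    moreover have "sqrt (exp (2 * t)) = exp t" for t :: real
      by (simp add: real_sqrt_unique exp_double)
    ultimately have "sqrt (G_coef z' (u, v)) * exp (J u) = sqrt (G_coef z' (u0, v)) * exp (J u0)"
      by (simp add: real_sqrt_mult)
    then show ?thesis by (simp add: p c_def q_def exp_minus field_simps)
  qed
  have c_pos: "c v > 0" if "v \<in> B" for v
    using G_pos[of "(u0, v)"] that AB q_pos[of u0] by (force simp: c_def)
  \<comment> \<open>\<open>G\<close> contains \<open>z_v\<close>, which costs one order of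
    smoothness; \<open>\<phi>\<close> regains it as an antiderivative of \<open>c\<close>.\<close>
  have c_ck: "ck_nat i B c" if i: "enat (Suc i) \<le> k" for i
  proof -
    have "ck_nat i D' (pd_v z')"
      using ck_nat_pd(2)[OF \<open>open D'\<close>] ck' i by (auto simp: ck_def simp del: ck_nat.simps)
    then have "ck_nat i B (\<lambda>v. pd_v z' (u0, v))"
      using AB by (intro ck_nat_slice[OF \<open>open D'\<close> \<open>open B\<close>]) auto
    then have "ck_nat i B (\<lambda>v. G_coef z' (u0, v))"
      unfolding G_coef_def by (intro ck_nat_bilinear[OF bounded_bilinear_lor] AB)
    moreover have "(\<lambda>v. G_coef z' (u0, v)) ` B \<subseteq> {0<..}"
      using G_pos AB by auto
    ultimately have "ck_nat i B (\<lambda>v. sqrt (G_coef z' (u0, v)))"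
      using ck_nat_compose[OF AB(6) open_greaterThan _ _ ck_nat_sqrt] by blast
    then show ?thesis
      unfolding c_def[abs_def] by (intro ck_nat_bilinear[OF bounded_bilinear_mult] ck_nat_const AB)
  qed
  have "continuous_on B c" using c_ck[of 0] enat_le_k[of 1] by (simp add: One_nat_def)
  then obtain \<phi> where \<phi>: "\<phi> v0 = v0" "\<And>v. v \<in> B \<Longrightarrow> (\<phi> has_vector_derivative c v) (at v)"
    using open_interval_antiderivative[of "v0 - d" "v0 + d" c v0 v0] AB(4) unfolding B_def by metis
  have "isCont \<phi> v0" using \<phi>(2)[OF AB(4)] has_vector_derivative_continuous by blast
  then obtain d' where d': "d' > 0" "\<And>v. dist v v0 < d' \<Longrightarrow> dist (\<phi> v) (\<phi> v0) < d"
    using d(1) unfolding continuous_at_eps_delta by metis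
  \<comment> \<open>Shrunk so that \<open>\<phi>\<close>, continuous at its fixed point
    \<open>v0\<close>, stays in the range of \<open>v\<close> on which the model is
    available.\<close>
  define B' where "B' = {v0 - min d d'<..<v0 + min d d'}"
  have B': "open B'" "convex B'" "v0 \<in> B'" "B' \<subseteq> B"
    using d d' by (auto simp: B'_def B_def)
  have \<phi>B: "\<phi> v \<in> B" if "v \<in> B'" for v
  proof -
    have "dist v v0 < d'" using that by (auto simp: B'_def dist_real_def)
    from d'(2)[OF this] show ?thesis by (auto simp: \<phi>(1) B_def dist_real_def)
  qed
  let ?U = "A \<times> B'"
  have U: "?U \<subseteq> D'" "?U \<subseteq> A \<times> B" using AB B' by auto
  have sub: "(fst p, \<phi> (snd p)) \<in> D" if "p \<in> ?U" for p
    using that \<phi>B AB by auto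
  obtain X Y l where f: "adapted_frame D (\<lambda>p. e (fst p)) (\<lambda>p. q (fst p)) (\<lambda>p. h (fst p))
      (\<lambda>p. - F (fst p) * e (fst p)) (\<lambda>p. n (fst p)) z X Y l"
    using z frame_on_def by auto
  have vd: "(\<phi> has_vector_derivative c (snd p)) (at (snd p))" if "p \<in> ?U" for p
    using that \<phi>(2) B' by auto
  note f1 = adapted_frame_reparam[OF f vd sub, unfolded fst_conv snd_conv]
  have "adapted_frame ?U (\<lambda>p. e (fst p)) (\<lambda>p. c (snd p) * q (fst p)) (\<lambda>p. c (snd p) * h (fst p))
      (\<lambda>p. - F (fst p) * e (fst p)) (\<lambda>p. c (snd p) * n (fst p)) z' (X_frame z') (Y_frame z') (unit_normal z')"
    unfolding adapted_frame_def
  proof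
    fix p assume p: "p \<in> ?U"
    then have G: "sqrt (G_coef z' p) = c (snd p) * q (fst p)" using sqrt_G U by blast
    have "p \<in> D'" using p U by blast
    note d = adapted_frameD[OF z'_frame this, unfolded G]
    have coef: "- deriv J (fst p) * (c (snd p) * q (fst p)) / e (fst p) = c (snd p) * h (fst p)"
      "G (fst p) * (c (snd p) * q (fst p)) = c (snd p) * n (fst p)"
      by (simp_all add: h_def n_def)
    from d show "lorentz_frame (X_frame z' p) (Y_frame z' p) (unit_normal z' p) \<and>
      has_pd_u z' (e (fst p) *\<^sub>R X_frame z' p) p \<and> has_pd_v z' ((c (snd p) * q (fst p)) *\<^sub>R Y_frame z' p) p \<and>
      has_pd_u (X_frame z') ((- F (fst p) * e (fst p)) *\<^sub>R unit_normal z' p) p \<and>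
      has_pd_v (X_frame z') ((c (snd p) * h (fst p)) *\<^sub>R Y_frame z' p) p \<and>
      has_pd_u (Y_frame z') 0 p \<and>
      has_pd_v (Y_frame z') ((c (snd p) * h (fst p)) *\<^sub>R X_frame z' p + (c (snd p) * n (fst p)) *\<^sub>R unit_normal z' p) p \<and>
      has_pd_u (unit_normal z') ((- F (fst p) * e (fst p)) *\<^sub>R X_frame z' p) p \<and>
      has_pd_v (unit_normal z') (- (c (snd p) * n (fst p)) *\<^sub>R Y_frame z' p) p"
      unfolding coef by blast
  qed
  from adapted_frame_congruence[OF AB(7) B'(2) _ _ f1 this]
  obtain T where T: "motion T" "\<And>p. p \<in> ?U \<Longrightarrow> z' p = T (z (fst p, \<phi> (snd p)))"
    using AB(3) B'(3) by blast
  have snd: "snd ` ?U = B'" using AB(3) by force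
  have "ck k B' \<phi>"
    unfolding ck_def
  proof (intro allI impI)
    fix i assume i: "enat i \<le> k"
    have d: "\<forall>x\<in>B'. (\<phi> has_vector_derivative c x) (at x)" using \<phi>(2) B' by blast
    show "ck_nat i B' \<phi>"
    proof (cases i)
      case 0
      then show ?thesis
        using d by (auto intro!: continuous_at_imp_continuous_on has_vector_derivative_continuous)
    next
      case (Suc i')
      have "ck_nat i' B' c" using c_ck[of i'] i Suc ck_nat_open_subset B' by blast
      with d Suc show ?thesis using ck_nat_Suc_real[OF B'(1)] by blast
    qed
  qed
  moreover have "deriv \<phi> v > 0" if "v \<in> B'" for v
    using \<phi>(2)[of v] c_pos[of v] that B'(4) DERIV_imp_deriv
    unfolding has_real_derivative_iff_has_vector_derivative[symmetric] by fastforce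
  moreover have "\<forall>(u, v)\<in>?U. (u, \<phi> v) \<in> D \<and> z' (u, v) = T (z (u, \<phi> v))"
    using T(2) sub by auto
  moreover have "open ?U" using AB B' by (intro open_Times)
  ultimately show ?thesis
    unfolding congruent_near_def
    using T(1) U(1) \<phi>(1) AB(3) B'(3) snd
    by (intro exI[of _ T] exI[of _ \<phi>] exI[of _ ?U]) auto
qed

end

section \<open>The integrals of a pair of Weingarten functions\<close>

lemma weingarten_functions_swap: "weingarten_functions k S f g \<Longrightarrow> weingarten_functions k S g f"
  by (auto simp: weingarten_functions_def mult.commute)

lemma Icc_subset_is_interval: "is_interval S \<Longrightarrow> a \<in> S \<Longrightarrow> b \<in> S \<Longrightarrow> {a..b::real} \<subseteq> S"
  unfolding is_interval_1 by (meson atLeastAtMost_iff subsetI)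

context
  fixes k :: enat and S :: "real set" and f g :: "real \<Rightarrow> real"
  assumes k: "1 \<le> k" and w: "weingarten_functions k S f g"
begin

lemma W_domain: "is_interval S" "interior S \<noteq> {}" "ck k S f" "ck k S g" "\<And>x. x \<in> S \<Longrightarrow> f x - g x \<noteq> 0"
  using w by (auto simp: weingarten_functions_def)

lemma W_C1: "f differentiable_on S" "continuous_on S (\<lambda>x. frechet_derivative f (at x within S) 1)"
  "continuous_on S f" "continuous_on S g"
proof -
  have "ck_nat (Suc 0) S f"
    using ck_nat_le[OF W_domain(3), of "Suc 0"] k by (simp add: one_enat_def del: ck_nat.simps)
  then show "f differentiable_on S" "continuous_on S (\<lambda>x. frechet_derivative f (at x within S) 1)"
    by auto
  have "enat 0 \<le> k" by (simp add: zero_enat_def[symmetric])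
  then show "continuous_on S f" "continuous_on S g"
    using ck_nat_le[OF W_domain(3)] ck_nat_le[OF W_domain(4)] ck_nat_continuous_on by blast+
qed

text \<open>A derivative within \<open>S\<close> is unique only at points that are not isolated in
  \<open>S\<close>. An interval with nonempty interior is connected and not a singleton, hence
  perfect, end points included.\<close>

lemma W_derivative:
  assumes "x \<in> S"
  shows "vector_derivative f (at x within S) = frechet_derivative f (at x within S) 1"
proof -
  have "S \<noteq> {x}" using W_domain(2) interior_singleton by metis
  then have "x islimpt S"
    using connected_imp_perfect W_domain(1) assms is_interval_connected by blast
  then have nb: "at x within S \<noteq> bot" by (simp add: trivial_limit_within)
  have "f differentiable (at x within S)" using assms W_C1(1) by (auto simp: differentiable_on_def)
  then have D: "(f has_derivative frechet_derivative f (at x within S)) (at x within S)"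
    by (simp add: frechet_derivative_works)
  let ?D = "frechet_derivative f (at x within S)"
  have "?D = (\<lambda>h. h *\<^sub>R ?D 1)"
  proof
    show "?D h = h *\<^sub>R ?D 1" for h
      using linear_simps(5)[OF has_derivative_bounded_linear[OF D], of h 1] by simp
  qed
  then have "(f has_vector_derivative ?D 1) (at x within S)"
    using D unfolding has_vector_derivative_def by (simp only:)
  then show ?thesis using vector_derivative_within[OF nb] by blast
qed

lemma W_integrand_continuous:
  "continuous_on S (\<lambda>t. vector_derivative f (at t within S) / (f t - g t))"
proof -
  have "continuous_on S (\<lambda>t. vector_derivative f (at t within S))"
    using W_C1(2) by (rule continuous_on_eq) (simp add: W_derivative)
  then show ?thesis using W_domain(5) W_C1 by (auto intro!: continuous_intros)
qed

lemma W_int_has_derivative: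
  assumes "c \<in> S" "x \<in> interior S"
  shows "(W_int S f g c has_vector_derivative vector_derivative f (at x) / (f x - g x)) (at x)"
proof -
  obtain d where d: "d > 0" "cball x d \<subseteq> S" using assms(2) mem_interior_cball by blast
  then have xd: "x - d \<in> S" "x + d \<in> S" by (auto simp: cball_def dist_real_def subset_iff)
  \<comment> \<open>An interval in \<open>S\<close> with the lower limit \<open>c\<close> in it and
    \<open>x\<close> in its interior, so that the fundamental theorem yields a two-sided derivative
    at \<open>x\<close>.\<close>
  define a b where "a = min c (x - d)" and "b = max c (x + d)"
  have ab: "{a..b} \<subseteq> S" "a \<le> c" "c \<le> b" "a < x" "x < b"
    using xd assms(1) d Icc_subset_is_interval[OF W_domain(1), of a b]
    by (auto simp: a_def b_def min_def max_def)
  have "(W_int S f g c has_vector_derivative vector_derivative f (at x within S) / (f x - g x)) (at x within {a..b})"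
    unfolding W_int_def[abs_def]
    by (rule interval_integral_FTC2[OF ab(2,3) continuous_on_subset[OF W_integrand_continuous ab(1)]])
      (use ab in auto)
  then show ?thesis
    using ab at_within_Icc_at[of a x b] at_within_interior[OF assms(2)] by simp
qed

text \<open>The derivative does not involve the lower limit, and the interior of an interval is
  convex.\<close>

lemma W_int_shift:
  assumes "c \<in> S" "d \<in> S"
  shows "\<exists>r. \<forall>x\<in>interior S. W_int S f g c x = r + W_int S f g d x"
proof -
  have "((\<lambda>x. W_int S f g c x - W_int S f g d x) has_vector_derivative 0) (at x)" if "x \<in> interior S" for x
    using has_vector_derivative_diff[OF W_int_has_derivative[OF assms(1) that] W_int_has_derivative[OF assms(2) that]]
    by simp
  moreover have "convex (interior S)" using W_domain(1) by (simp add: is_interval_convex_1 convex_interior)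
  ultimately obtain r where "\<And>x. x \<in> interior S \<Longrightarrow> W_int S f g c x - W_int S f g d x = r"
    using real_zero_derivative_constant[of "interior S" "\<lambda>x. W_int S f g c x - W_int S f g d x"] W_domain(2)
    by (metis ex_in_conv)
  then show ?thesis by (intro exI[of _ r]) (auto simp: algebra_simps)
qed

lemma W_int_ck:
  assumes "c \<in> S"
  shows "ck k (interior S) (W_int S f g c)"
  unfolding ck_def
proof (intro allI impI)
  fix n assume n: "enat n \<le> k"
  note d = W_int_has_derivative[OF assms]
  show "ck_nat n (interior S) (W_int S f g c)"
  proof (cases n)
    case 0
    then show ?thesis using d
      by (auto intro!: continuous_at_imp_continuous_on has_vector_derivative_continuous)
  next
    case (Suc m)
    have "ck_nat (Suc m) (interior S) f" "ck_nat (Suc m) (interior S) g"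
      using ck_nat_open_subset[OF _ open_interior interior_subset] W_domain n Suc
      unfolding ck_def by blast+
    then have fg: "ck_nat m (interior S) f" "ck_nat m (interior S) g"
      and "\<exists>f'. (\<forall>x\<in>interior S. (f has_vector_derivative f' x) (at x)) \<and> ck_nat m (interior S) f'"
      using ck_nat_Suc_imp ck_nat_Suc_real[OF open_interior] by blast+
    then obtain f' where "\<forall>x\<in>interior S. (f has_vector_derivative f' x) (at x)" "ck_nat m (interior S) f'"
      by blast
    then have f': "ck_nat m (interior S) (\<lambda>x. vector_derivative f (at x))"
      using ck_nat_cong[of m "interior S" f' "\<lambda>x. vector_derivative f (at x)"] vector_derivative_at by metis
    have diff: "ck_nat m (interior S) (\<lambda>x. f x + - g x)"
      using fg by (intro ck_nat_add open_interior ck_nat_bounded_linear[OF bounded_linear_minus[OF bounded_linear_ident]])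
    \<comment> \<open>\<open>inverse\<close> is known to be smooth on positive numbers, while
      \<open>f - g\<close> may be negative. So \<open>1 / (f - g)\<close> is written as
      \<open>f - g\<close> times the inverse of its square.\<close>
    have sq: "ck_nat m (interior S) (\<lambda>x. inverse ((f x + - g x) * (f x + - g x)))"
    proof (rule ck_nat_compose[where \<psi> = inverse and \<phi> = "\<lambda>x. (f x + - g x) * (f x + - g x)",
          OF open_interior open_greaterThan _ _ ck_nat_inverse])
      show "(\<lambda>x. (f x + - g x) * (f x + - g x)) ` interior S \<subseteq> {0<..}"
        using W_domain(5) interior_subset by (force simp: zero_less_mult_iff linorder_neq_iff)
      show "ck_nat m (interior S) (\<lambda>x. (f x + - g x) * (f x + - g x))"
        by (intro ck_nat_bilinear[OF bounded_bilinear_mult] diff open_interior)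
    qed
    have "ck_nat m (interior S) (\<lambda>x. vector_derivative f (at x) * ((f x + - g x) * inverse ((f x + - g x) * (f x + - g x))))"
      by (intro ck_nat_bilinear[OF bounded_bilinear_mult] f' diff sq open_interior)
    then have "ck_nat m (interior S) (\<lambda>x. vector_derivative f (at x) / (f x - g x))"
    proof (rule ck_nat_cong)
      fix x assume "x \<in> interior S"
      then have "f x - g x \<noteq> 0" using W_domain(5) interior_subset by blast
      then show "vector_derivative f (at x) * ((f x + - g x) * inverse ((f x + - g x) * (f x + - g x))) =
        vector_derivative f (at x) / (f x - g x)"
        by (simp add: divide_inverse)
    qed
    with d show ?thesis unfolding Suc ck_nat_Suc_real[OF open_interior]
      by (intro exI[of _ "\<lambda>x. vector_derivative f (at x) / (f x - g x)"]) auto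
  qed
qed

lemma f_interior_derivative:
  assumes "x \<in> interior S"
  shows "(f has_real_derivative vector_derivative f (at x)) (at x)" "vector_derivative f (at x) \<noteq> 0"
proof -
  have "f differentiable (at x within S)"
    using assms interior_subset W_C1(1) by (auto simp: differentiable_on_def)
  then show "(f has_real_derivative vector_derivative f (at x)) (at x)"
    unfolding at_within_interior[OF assms] has_real_derivative_iff_has_vector_derivative
    by (rule vector_derivative_works[THEN iffD1])
  show "vector_derivative f (at x) \<noteq> 0"
    using w assms interior_subset at_within_interior[OF assms] unfolding weingarten_functions_def by force
qed

end

text \<open>Near \<open>u\<close> the function takes values on both sides of \<open>\<nu> u\<close>,
  and the interval \<open>S\<close> contains everything between them. End points of
  \<open>S\<close>, with their one-sided derivatives, are thus never met.\<close>

lemma nonzero_deriv_in_interior: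
  fixes \<nu> :: "real \<Rightarrow> real"
  assumes "is_interval S" "open \<Omega>" "u \<in> \<Omega>" "\<nu> ` \<Omega> \<subseteq> S" "(\<nu> has_real_derivative D) (at u)" "D \<noteq> 0"
  shows "\<nu> u \<in> interior S"
proof -
  obtain d where d: "d > 0" "ball u d \<subseteq> \<Omega>" using assms(2,3) openE by blast
  have in\<Omega>: "u + h \<in> \<Omega>" "u - h \<in> \<Omega>" if "0 < h" "h < d" for h
    using that d by (auto simp: subset_iff dist_real_def)
  have "\<exists>x\<in>\<Omega>. \<exists>y\<in>\<Omega>. \<nu> x < \<nu> u \<and> \<nu> u < \<nu> y"
  proof (cases "D > 0")
    case True
    then obtain d1 d2 where d12: "d1 > 0" "\<forall>h>0. h < d1 \<longrightarrow> \<nu> u < \<nu> (u + h)" "d2 > 0" "\<forall>h>0. h < d2 \<longrightarrow> \<nu> (u - h) < \<nu> u"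
      using DERIV_pos_inc_right[OF assms(5)] DERIV_pos_inc_left[OF assms(5)] by blast
    define h where "h = min d (min d1 d2) / 2"
    have h: "0 < h" "h < d" "h < d1" "h < d2" using d d12 by (auto simp: h_def)
    then show ?thesis using d12 in\<Omega>[OF h(1,2)] by blast
  next
    case False
    then have "D < 0" using assms(6) by simp
    then obtain d1 d2 where d12: "d1 > 0" "\<forall>h>0. h < d1 \<longrightarrow> \<nu> u > \<nu> (u + h)" "d2 > 0" "\<forall>h>0. h < d2 \<longrightarrow> \<nu> (u - h) > \<nu> u"
      using DERIV_neg_dec_right[OF assms(5)] DERIV_neg_dec_left[OF assms(5)] by blast
    define h where "h = min d (min d1 d2) / 2"
    have h: "0 < h" "h < d" "h < d1" "h < d2" using d d12 by (auto simp: h_def)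
    then show ?thesis using d12 in\<Omega>[OF h(1,2)] by blast
  qed
  then obtain x y where xy: "\<nu> x \<in> S" "\<nu> y \<in> S" "\<nu> u \<in> {\<nu> x<..<\<nu> y}" using assms(4) by force
  have "{\<nu> x<..<\<nu> y} \<subseteq> S" using Icc_subset_is_interval[OF assms(1) xy(1,2)] by auto
  then show ?thesis using xy(3) interior_maximal open_greaterThanLessThan by blast
qed

lemma ck_compose:
  fixes \<phi> \<psi> :: "real \<Rightarrow> real"
  assumes "open S" "open T" "\<phi> ` S \<subseteq> T" "ck k S \<phi>" "ck k T \<psi>"
  shows "ck k S (\<lambda>x. \<psi> (\<phi> x))"
  using ck_nat_compose[OF assms(1-3)] assms(4,5) unfolding ck_def by blast

text \<open>By the fundamental theorem and the chain rule, \<open>J' = g' \<nu>' / (g - f)\<close>.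
  Multiplied by \<open>g - f\<close> this is the Codazzi condition, and it does not vanish because
  \<open>g'\<close> and \<open>\<nu>'\<close> do not. All compositions take place on the interior of
  \<open>S\<close>.\<close>

lemma weingarten_profile_of_functions:
  fixes \<nu> :: "real \<Rightarrow> real"
  assumes k: "3 \<le> k" and w: "weingarten_functions k S f g"
    and \<Omega>: "open \<Omega>" and ck: "ck k \<Omega> \<nu>" and \<nu>: "\<And>u. u \<in> \<Omega> \<Longrightarrow> \<nu> u \<in> S" "\<And>u. u \<in> \<Omega> \<Longrightarrow> deriv \<nu> u \<noteq> 0"
    and c: "c \<in> S" and a: "a > 0"
  defines "I \<equiv> \<lambda>u. W_int S f g c (\<nu> u)" and "J \<equiv> \<lambda>u. W_int S g f c (\<nu> u)"
  assumes gauss: "\<And>u. u \<in> \<Omega> \<Longrightarrow>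
      a\<^sup>2 * exp (2 * I u) * (deriv (deriv J) u + deriv I u * deriv J u - (deriv J u)\<^sup>2) = - (f (\<nu> u) * g (\<nu> u))"
  shows "weingarten_profile k \<Omega> (\<lambda>u. f (\<nu> u)) (\<lambda>u. g (\<nu> u)) I J a" "\<And>u. u \<in> \<Omega> \<Longrightarrow> \<nu> u \<in> interior S"
proof -
  have k1: "1 \<le> k" using k by (metis one_le_numeral order_trans)
  note w' = weingarten_functions_swap[OF w]
  have "ck_nat (Suc 0) \<Omega> \<nu>"
    using ck k1 by (auto simp: ck_def one_enat_def simp del: ck_nat.simps)
  then obtain \<nu>' where "\<forall>u\<in>\<Omega>. (\<nu> has_vector_derivative \<nu>' u) (at u)"
    unfolding ck_nat_Suc_real[OF \<Omega>] by blast
  then have d\<nu>: "(\<nu> has_real_derivative deriv \<nu> u) (at u)" if "u \<in> \<Omega>" for u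
    using that DERIV_imp_deriv unfolding has_real_derivative_iff_has_vector_derivative[symmetric] by metis
  show int: "\<nu> u \<in> interior S" if "u \<in> \<Omega>" for u
    using nonzero_deriv_in_interior[OF W_domain(1)[OF k1 w] \<Omega> that _ d\<nu>[OF that] \<nu>(2)[OF that]] \<nu>(1) by blast
  then have img: "\<nu> ` \<Omega> \<subseteq> interior S" by blast
  note comp = ck_compose[OF \<Omega> open_interior img ck]
  note sub = ck_open_subset[OF _ open_interior interior_subset]
  have dg: "((\<lambda>u. g (\<nu> u)) has_real_derivative vector_derivative g (at (\<nu> u)) * deriv \<nu> u) (at u)"
    if "u \<in> \<Omega>" for u
    by (rule DERIV_chain2[OF f_interior_derivative(1)[OF k1 w' int[OF that]] d\<nu>[OF that]])
  have dJ: "deriv J u = vector_derivative g (at (\<nu> u)) / (g (\<nu> u) - f (\<nu> u)) * deriv \<nu> u" if "u \<in> \<Omega>" for u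
    unfolding J_def
    by (rule DERIV_imp_deriv, rule DERIV_chain2[OF _ d\<nu>[OF that]])
      (use W_int_has_derivative[OF k1 w' c int[OF that]] in \<open>simp add: has_real_derivative_iff_has_vector_derivative\<close>)
  have ne: "f (\<nu> u) \<noteq> g (\<nu> u)" if "u \<in> \<Omega>" for u
    using W_domain(5)[OF k1 w] \<nu>(1)[OF that] by force
  show "weingarten_profile k \<Omega> (\<lambda>u. f (\<nu> u)) (\<lambda>u. g (\<nu> u)) I J a"
  proof
    show "ck k \<Omega> (\<lambda>u. f (\<nu> u))" "ck k \<Omega> (\<lambda>u. g (\<nu> u))"
      by (intro comp sub W_domain[OF k1 w])+
    show "ck k \<Omega> I" "ck k \<Omega> J"
      unfolding I_def J_def by (intro comp W_int_ck[OF k1 w c] W_int_ck[OF k1 w' c])+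
    fix u assume u: "u \<in> \<Omega>"
    show "f (\<nu> u) \<noteq> g (\<nu> u)" by (rule ne[OF u])
    show "deriv J u \<noteq> 0"
      using dJ[OF u] ne[OF u] \<nu>(2)[OF u] f_interior_derivative(2)[OF k1 w' int[OF u]] by simp
    show "((\<lambda>u. g (\<nu> u)) has_real_derivative deriv J u * (g (\<nu> u) - f (\<nu> u))) (at u)"
      using dg[OF u] ne[OF u] by (simp add: dJ[OF u])
  qed (use k \<Omega> a gauss in auto)
qed

theorem theorem3p7:
  fixes k :: enat
    and S :: "real set" and f g :: "real \<Rightarrow> real"
    and D :: "(real \<times> real) set" and \<nu> :: "real \<Rightarrow> real"
    and u0 v0 a :: real
  assumes "3 \<le> k"
    and "weingarten_functions k S f g"
    and "open D"
    and "ck k (fst ` D) \<nu>"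
    and "\<And>u v. (u, v) \<in> D \<Longrightarrow> \<nu> u \<in> S \<and> deriv \<nu> u \<noteq> 0"
    and "(u0, v0) \<in> D"
    and "a > 0"
  defines "I \<equiv> \<lambda>u. W_int S f g (\<nu> u0) (\<nu> u)"
    and "J \<equiv> \<lambda>u. W_int S g f (\<nu> u0) (\<nu> u)"
  defines "sol \<equiv> \<lambda>D' z. has_invariants D' z (\<lambda>(u, v). f (\<nu> u)) (\<lambda>(u, v). g (\<nu> u))
                    (\<lambda>(u, v). 0) (\<lambda>(u, v). a * exp (I u) * deriv J u)"
  assumes "\<And>u v. (u, v) \<in> D \<Longrightarrow>
      a\<^sup>2 * exp (2 * I u) * (deriv (deriv J) u + deriv I u * deriv J u - (deriv J u)\<^sup>2)
        = - (f (\<nu> u) * g (\<nu> u))"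
  shows "\<exists>D0 z. open D0 \<and> connected D0 \<and> (u0, v0) \<in> D0 \<and> D0 \<subseteq> D \<and>
      weingarten_surface k D0 z \<and> sol D0 z \<and>
      (\<forall>D' z'. (u0, v0) \<in> D' \<and> D' \<subseteq> D \<and> weingarten_surface k D' z' \<and> sol D' z' \<longrightarrow>
         congruent_near k (u0, v0) D0 z D' z') \<and>
      (\<forall>z'. natural_principal k D0 z' S f g (\<lambda>(u, v). \<nu> u) \<and> sol D0 z' \<and>
             G_coef z' (u0, v0) = G_coef z (u0, v0) \<longrightarrow>
         (\<exists>T. motion T \<and> (\<forall>p\<in>D0. z' p = T (z p)))) \<and>
      natural_principal k D0 z S f g (\<lambda>(u, v). \<nu> u)"
proof -
  define \<Omega> where "\<Omega> = fst ` D"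
  have \<Omega>: "open \<Omega>" unfolding \<Omega>_def using assms(3) by (rule open_image_fst)
  have k1: "1 \<le> k" using assms(1) by (metis one_le_numeral order_trans)
  note w = assms(2) and w' = weingarten_functions_swap[OF assms(2)]
  have c: "\<nu> u0 \<in> S" using assms(5,6) by blast
  have \<nu>: "u \<in> \<Omega> \<Longrightarrow> \<nu> u \<in> S" "u \<in> \<Omega> \<Longrightarrow> deriv \<nu> u \<noteq> 0" for u
    using assms(5) by (auto simp: \<Omega>_def)
  have gauss: "u \<in> \<Omega> \<Longrightarrow> a\<^sup>2 * exp (2 * I u) * (deriv (deriv J) u + deriv I u * deriv J u - (deriv J u)\<^sup>2)
        = - (f (\<nu> u) * g (\<nu> u))" for u
    using assms(11) by (auto simp: \<Omega>_def)
  note profile = weingarten_profile_of_functions[OF assms(1,2) \<Omega> assms(4)[folded \<Omega>_def] \<nu> c assms(7)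
      gauss[unfolded I_def J_def], folded I_def J_def]
  interpret weingarten_profile k \<Omega> "\<lambda>u. f (\<nu> u)" "\<lambda>u. g (\<nu> u)" I J a by (rule profile(1))
  obtain d where d: "d > 0" "{u0 - d<..<u0 + d} \<times> {v0 - d<..<v0 + d} \<subseteq> D"
    using open_contains_square assms(3,6) by blast
  \<comment> \<open>The domain is a box because uniqueness on all of it compares frames over a
    product of convex sets.\<close>
  define A B where "A = {u0 - d<..<u0 + d}" and "B = {v0 - d<..<v0 + d}"
  have AB: "A \<times> B \<subseteq> D" "u0 \<in> A" "v0 \<in> B" "open A" "open B" "convex A" "convex B"
    using d by (auto simp: A_def B_def)
  let ?D0 = "A \<times> B"
  have A\<Omega>: "A \<subseteq> \<Omega>" using AB unfolding \<Omega>_def by force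
  have D0: "open ?D0" "connected ?D0" "(u0, v0) \<in> ?D0" "fst ` ?D0 \<subseteq> \<Omega>"
    using AB A\<Omega> by (auto intro: open_Times convex_Times convex_connected)
  obtain z where z: "ck k (A \<times> UNIV) z" "frame_on (A \<times> UNIV) z"
    using surface_exists[of u0 "u0 - d" "u0 + d"] AB(2) A\<Omega> unfolding A_def by blast
  have zf: "frame_on ?D0 z" using frame_on_subset z(2) by blast
  have zck: "ck k ?D0 z" using ck_open_subset z(1) D0(1) by blast
  note inv = frame_invariants[OF zf D0(1,4)]
  have ts: "timelike_surface k ?D0 z" by (rule frame_timelike[OF zf D0(1,4) zck])
  have sol_iff: "sol D' z' \<longleftrightarrow> (\<forall>p\<in>D'. nu1 z' p = f (\<nu> (fst p)) \<and> nu2 z' p = g (\<nu> (fst p)) \<and>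
      gamma1 z' p = 0 \<and> gamma2 z' p = a * exp (I (fst p)) * deriv J (fst p))" for D' z'
    by (simp add: sol_def has_invariants_def split_beta)
  have sol: "sol ?D0 z" unfolding sol_iff using inv by blast
  have \<nu>_fst: "(\<lambda>(u, v). \<nu> u) = (\<lambda>p. \<nu> (fst p))" by (simp add: fun_eq_iff)
  have ck\<nu>: "ck k ?D0 (\<lambda>(u, v). \<nu> u)"
    unfolding \<nu>_fst ck_def
  proof (intro allI impI)
    fix i assume "enat i \<le> k"
    then have "ck_nat i \<Omega> \<nu>" using assms(4) by (simp add: ck_def \<Omega>_def)
    then show "ck_nat i ?D0 (\<lambda>p. \<nu> (fst p))"
      using ck_nat_compose[where \<phi> = fst and \<psi> = \<nu>, OF D0(1) \<Omega> D0(4)]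
        ck_nat_bounded_linear[OF bounded_linear_fst D0(1) ck_nat_id[OF D0(1)]] by blast
  qed
  have ww: "weingarten_with k ?D0 z S f g (\<lambda>(u, v). \<nu> u)"
    unfolding weingarten_with_def using ts w ck\<nu> sol \<nu>(1) A\<Omega> unfolding sol_iff by auto
  have sqE: "sqrt (- E_coef z p) = exp (- I (fst p)) / a" and sqG: "sqrt (G_coef z p) = q (fst p)"
    if "p \<in> ?D0" for p
    using inv(1,2)[OF that] e_pos[of "fst p"] q_pos[of "fst p"] assms(7) by (simp_all add: e_def less_imp_le)
  have "natural_principal k ?D0 z S f g (\<lambda>(u, v). \<nu> u)"
    unfolding natural_principal_def
  proof (intro conjI ballI ww)
    fix c' assume c': "c' \<in> S"
    \<comment> \<open>Another lower limit adds a constant \<open>r\<close> to \<open>I\<close>, and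
      \<open>exp I\<close> cancels against \<open>sqrt (- E) = exp (- I) / a\<close>.\<close>
    obtain r where r: "\<forall>x\<in>interior S. W_int S f g c' x = r + W_int S f g (\<nu> u0) x"
      using W_int_shift[OF k1 w c' c] by blast
    have "sqrt (- E_coef z p) * exp (W_int S f g c' (\<nu> (fst p))) = exp r / a" if "p \<in> ?D0" for p
    proof -
      have "\<nu> (fst p) \<in> interior S" using profile(2) that A\<Omega> by auto
      then have "W_int S f g c' (\<nu> (fst p)) = r + I (fst p)" using r by (simp add: I_def)
      then show ?thesis by (simp add: sqE[OF that] exp_add exp_minus)
    qed
    then show "(\<lambda>p. sqrt (- E_coef z p) * exp (W_int S f g c' (case p of (u, v) \<Rightarrow> \<nu> u))) constant_on ?D0"
      unfolding constant_on_def split_beta by blast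
    obtain r' where r': "\<forall>x\<in>interior S. W_int S g f c' x = r' + W_int S g f (\<nu> u0) x"
      using W_int_shift[OF k1 w' c' c] by blast
    have "sqrt (G_coef z p) * exp (W_int S g f c' (\<nu> (fst p))) = exp r'" if "p \<in> ?D0" for p
    proof -
      have "\<nu> (fst p) \<in> interior S" using profile(2) that A\<Omega> by auto
      then have "W_int S g f c' (\<nu> (fst p)) = r' + J (fst p)" using r' by (simp add: J_def)
      then show ?thesis by (simp add: sqG[OF that] q_def exp_add exp_minus)
    qed
    then show "(\<lambda>p. sqrt (G_coef z p) * exp (W_int S g f c' (case p of (u, v) \<Rightarrow> \<nu> u))) constant_on ?D0"
      unfolding constant_on_def split_beta by blast
  qed
  moreover have "congruent_near k (u0, v0) ?D0 z D' z'"
    if "(u0, v0) \<in> D'" "D' \<subseteq> D" "weingarten_surface k D' z'" "sol D' z'" for D' z'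
  proof (rule congruent_nearI[OF _ _ that(1) _ _ _ zf D0(1,3)])
    show "timelike_surface k D' z'"
      using that(3) by (auto simp: weingarten_surface_def weingarten_with_def)
    show "fst ` D' \<subseteq> \<Omega>" using that(2) by (auto simp: \<Omega>_def)
  qed (use that(4) in \<open>auto simp: sol_iff\<close>)
  moreover have "\<exists>T. motion T \<and> (\<forall>p\<in>?D0. z' p = T (z p))"
    if nat: "natural_principal k ?D0 z' S f g (\<lambda>(u, v). \<nu> u)" and s: "sol ?D0 z'"
      and G0: "G_coef z' (u0, v0) = G_coef z (u0, v0)" for z'
  proof (rule congruent_if_G_eq[OF _ A\<Omega> AB(6,7) _ _ _ _ _ _ zf])
    show "timelike_surface k ?D0 z'"
      using nat by (auto simp: natural_principal_def weingarten_with_def)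
    show "sqrt (G_coef z' p) = q (fst p)" if p: "p \<in> ?D0" for p
    proof -
      \<comment> \<open>Naturality makes \<open>sqrt G * exp J\<close> constant. Its value is found
        at \<open>(u0, v0)\<close>, where \<open>G\<close> agrees with that of the model.\<close>
      have "(\<lambda>p. sqrt (G_coef z' p) * exp (W_int S g f (\<nu> u0) (case p of (u, v) \<Rightarrow> \<nu> u))) constant_on ?D0"
        using nat c unfolding natural_principal_def by blast
      then obtain y where y: "\<And>p. p \<in> ?D0 \<Longrightarrow> sqrt (G_coef z' p) * exp (J (fst p)) = y"
        unfolding constant_on_def split_beta J_def by blast
      have "sqrt (G_coef z' p) * exp (J (fst p)) = q u0 * exp (J u0)"
        using y[OF p] y[OF D0(3)] sqG[OF D0(3)] G0 by simp
      then show ?thesis by (simp add: q_def exp_minus field_simps)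
    qed
  qed (use s AB in \<open>auto simp: sol_iff\<close>)
  moreover have "weingarten_surface k ?D0 z" unfolding weingarten_surface_def using ww by blast
  ultimately show ?thesis using D0(1-3) AB(1) sol by blast
qed

end
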